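(* Let $A$ be a $3\times 3$ matrix defining a generalized rolling constraint, of rank $j\in\{0,1,2,3\}$. Let $\{\cdot,\cdot\}_{\mathrm{nh}}$ be the nonholonomic bracket on the constraint manifold $\mathcal{M}$ for the rigid body subject to $\dot{\mathbf x}=rA\omega$, and let $\{\cdot,\cdot\}_{\mathrm{red}}$ be the reduced bracket on $\mathcal{R}=\mathcal{M}/H\cong S^2\times\mathbb{R}^3$, characterized by $\{f_1,f_2\}_{\mathrm{red}}\circ\rho=\{f_1\circ\rho,f_2\circ\rho\}_{\mathrm{nh}}$ for $f_1,f_2\in C^\infty(\mathcal{R})$. Then $\{\cdot,\cdot\}_{\mathrm{red}}$ is precisely the restriction to the Casimir level set $\|\gamma\|=1$ of the bracket $$\{f_1,f_2\}_{\mathrm{Rank}j}=-N_j\cdot\left(\frac{\partial f_1}{\partial K}\times\frac{\partial f_2}{\partial K}\right)-\gamma\cdot\left(\frac{\partial f_1}{\partial K}\times\frac{\partial f_2}{\partial\gamma}-\frac{\partial f_2}{\partial K}\times\frac{\partial f_1}{\partial\gamma}\right),$$ where $N_0=K$, $N_1=K+mr^2(\Omega\cdot\gamma)\gamma$, $N_2=K+mr^2\Omega-mr^2(\Omega\cdot\gamma)\gamma$, $N_3=K+mr^2\Omega$.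
   Context: Generalized rolling constraint: $A=\begin{pmatrix}C&0\\0&1\end{pmatrix}$, $C\in SO(2)$ (rank 3); $A=\begin{pmatrix}C&0\\0&0\end{pmatrix}$, $C\in SO(2)$ (rank 2); $A=e_3e_3^T$ (rank 1); or $A=0$ (rank 0). System: $Q=SO(3)\times\mathbb{R}^3\ni(g,\mathbf{x})$; $m,r>0$; $\mathbb{I}=\mathrm{diag}(I_1,I_2,I_3)$ with positive entries. Identify $\mathfrak{so}(3)\cong\mathbb{R}^3$ by the hat map; $\hat\omega=\dot gg^{-1}$, $\hat\Omega=g^{-1}\dot g$, so $\omega=g\Omega$. The Lagrangian is $\mathcal{L}=\frac12(\mathbb{I}\Omega)\cdot\Omega+\frac m2\|\dot{\mathbf x}\|^2$. The constraint distribution $\mathcal{D}\subset TQ$ is $\dot{\mathbf x}=rAg\Omega$, the annihilator of the $\mathbb{R}^3$-valued 1-form $\epsilon=d\mathbf{x}-rAg\lambda$ ($\lambda$ the left Maurer–Cartan form on $SO(3)$). Nonholonomic bracket: $\mathcal{M}=\mathrm{Leg}(\mathcal{D})\subset T^*Q$ (image under the Legendre transform), $\Omega_Q=-d\Theta$ is the canonical 2-form of $T^*Q$ ($\sum dq^i\wedge dp_i$), $\tau:T^*Q\to Q$, $\mathcal{C}=T\mathcal{M}\cap\{v:\langle\tau^*\epsilon,v\rangle=0\}$, and $\Omega_{\mathcal C}$ is the restriction of $\Omega_Q$ to $\mathcal{C}$, which is nondegenerate. For $f\in C^\infty(\mathcal{M})$, $X_f\in\Gamma(\mathcal{C})$ is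 defined by $\mathbf{i}_{X_f}\Omega_{\mathcal C}=df|_{\mathcal C}$, and $\{f_1,f_2\}_{\mathrm{nh}}=\Omega_{\mathcal C}(X_{f_1},X_{f_2})=X_{f_2}(f_1)$. Points of $\mathcal{M}$ are parametrized by $(g,\mathbf{x},K)\in SO(3)\times\mathbb{R}^3\times\mathbb{R}^3$, where $K=\mathbb{I}\Omega+mr^2g^{-1}A^TAg\,\Omega$. Reduction: $H=\{(h,y)\in SE(3):he_3=e_3\}$ acts on $Q$ by $(h,y)\cdot(g,\mathbf{x})=(hg,h\mathbf{x}+y)$; the cotangent lift restricts to a free and proper action on $\mathcal{M}$ preserving $\{\cdot,\cdot\}_{\mathrm{nh}}$. The orbit projection is $\rho:\mathcal{M}\to\mathcal{R}\cong S^2\times\mathbb{R}^3$, $\rho(g,\mathbf{x},K)=(\gamma,K)$, $\gamma=g^{-1}e_3$. On $\|\gamma\|=1$, $\Omega$ is the function of $(\gamma,K)$ determined by $K=\mathbb{I}\Omega$ (rank 0), $K=\mathbb{I}\Omega+mr^2(\Omega\cdot\gamma)\gamma$ (rank 1), $K=(\mathbb{I}+mr^2E)\Omega-mr^2(\Omega\cdot\gamma)\gamma$ (rank 2), $K=(\mathbb{I}+mr^2E)\Omega$ (rank 3), $E$ the identity matrix. The entries of $\gamma$ are redundant coordinates on $S^2$; $\|\gamma\|^2$ is a Casimir function of each $\{\cdot,\cdot\}_{\mathrm{Rank}j}$. *)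

theory Defs
  imports "HOL-Analysis.Analysis"
begin

section \<open>Submanifolds of Euclidean spaces\<close>

text \<open>
  All manifolds below are smooth embedded submanifolds of Euclidean spaces, given by their underlying
  sets.  For such a set, the velocities at \<open>x\<close> of curves in it that are differentiable at
  time 0 are exactly the tangent vectors at \<open>x\<close>.
\<close>

definition has_velocity :: "'a::real_normed_vector set \<Rightarrow> 'a \<Rightarrow> 'a \<Rightarrow> (real \<Rightarrow> 'a) \<Rightarrow> bool" where
  "has_velocity S x v c \<longleftrightarrow> c 0 = x \<and> (\<forall>t. c t \<in> S) \<and> (c has_vector_derivative v) (at 0)"

definition tangent_at :: "'a::real_normed_vector set \<Rightarrow> 'a \<Rightarrow> 'a set" where
  "tangent_at S x = {v. \<exists>c. has_velocity S x v c}"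

text \<open>The differential at \<open>x\<close>, applied to \<open>v\<close>, of a function \<open>f\<close> on \<open>S\<close>; values of \<open>f\<close> off \<open>S\<close> play
  no role.\<close>

definition differential :: "'a::real_normed_vector set \<Rightarrow> ('a \<Rightarrow> real) \<Rightarrow> 'a \<Rightarrow> 'a \<Rightarrow> real" where
  "differential S f x v =
     (THE d. \<forall>c. has_velocity S x v c \<longrightarrow> ((\<lambda>t. f (c t)) has_real_derivative d) (at 0))"

text \<open>Class \<open>C\<^sup>n\<close> on an open subset of a Euclidean space.\<close>

primrec Ck_on :: "nat \<Rightarrow> 'a::euclidean_space set \<Rightarrow> ('a \<Rightarrow> real) \<Rightarrow> bool" where
  "Ck_on 0 U f \<longleftrightarrow> continuous_on U f"
| "Ck_on (Suc n) U f \<longleftrightarrow>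
     (\<forall>x\<in>U. f differentiable (at x)) \<and> (\<forall>v. Ck_on n U (\<lambda>x. frechet_derivative f (at x) v))"

definition smooth_on_open :: "'a::euclidean_space set \<Rightarrow> ('a \<Rightarrow> real) \<Rightarrow> bool" where
  "smooth_on_open U f \<longleftrightarrow> open U \<and> (\<forall>n. Ck_on n U f)"

text \<open>\<open>C\<^sup>\<infinity>(S)\<close>: the functions that extend smoothly to the ambient space near each point of \<open>S\<close>.\<close>

definition smooth_functions :: "'a::euclidean_space set \<Rightarrow> ('a \<Rightarrow> real) set" where
  "smooth_functions S =
     {f. \<forall>x\<in>S. \<exists>U F. x \<in> U \<and> smooth_on_open U F \<and> (\<forall>y\<in>U \<inter> S. F y = f y)}"


section \<open>Cotangent bundles and the Legendre transform\<close>

text \<open>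
  The ambient inner product identifies a covector at \<open>q\<close> with a tangent vector \<open>p\<close> of \<open>Q\<close> at \<open>q\<close>, the
  pairing being \<open>p \<bullet> v\<close>.  So \<open>T\<^sup>*Q\<close> is the submanifold of pairs \<open>(q, p)\<close>, the projection to \<open>Q\<close>
  (and its tangent map) is \<^const>\<open>fst\<close>, and the form \<open>\<Theta>\<close> below, defined on the ambient space,
  pulls back to the canonical 1-form of \<open>T\<^sup>*Q\<close>.  Pullback commutes with the exterior derivative, so
  the canonical 2-form is obtained by evaluating \<open>-d\<Theta>\<close> on tangent vectors of \<open>T\<^sup>*Q\<close>.
\<close>

definition canonical_one_form :: "'a::euclidean_space \<times> 'a \<Rightarrow> 'a \<times> 'a \<Rightarrow> real" where
  "canonical_one_form z v = snd z \<bullet> fst v"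

text \<open>The exterior derivative \<open>d\<alpha>\<^sub>z(u, v)\<close> of a 1-form on a vector space; \<open>u\<close> and \<open>v\<close> are extended to
  constant, hence commuting, vector fields.\<close>

definition exterior_derivative ::
    "('a::real_normed_vector \<Rightarrow> 'a \<Rightarrow> real) \<Rightarrow> 'a \<Rightarrow> 'a \<Rightarrow> 'a \<Rightarrow> real" where
  "exterior_derivative \<alpha> z u v =
     frechet_derivative (\<lambda>y. \<alpha> y v) (at z) u - frechet_derivative (\<lambda>y. \<alpha> y u) (at z) v"

definition canonical_two_form ::
    "'a::euclidean_space \<times> 'a \<Rightarrow> 'a \<times> 'a \<Rightarrow> 'a \<times> 'a \<Rightarrow> real" where
  "canonical_two_form z u v = - exterior_derivative canonical_one_form z u v"

definition Legendre :: "'a::euclidean_space set \<Rightarrow> ('a \<Rightarrow> 'a \<Rightarrow> real) \<Rightarrow> 'a \<Rightarrow> 'a \<Rightarrow> 'a" where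
  "Legendre Q L q v =
     (THE p. p \<in> tangent_at Q q \<and>
        (\<forall>w\<in>tangent_at Q q. ((\<lambda>t. L q (v + t *\<^sub>R w)) has_real_derivative p \<bullet> w) (at 0)))"

text \<open>The cotangent lift of a diffeomorphism of \<open>Q\<close> (extended to the ambient space).\<close>

definition cotangent_lift :: "'a::euclidean_space set \<Rightarrow> ('a \<Rightarrow> 'a) \<Rightarrow> 'a \<times> 'a \<Rightarrow> 'a \<times> 'a" where
  "cotangent_lift Q \<phi> = (\<lambda>(q, p).
     (\<phi> q, THE p'. p' \<in> tangent_at Q (\<phi> q) \<and>
        (\<forall>v\<in>tangent_at Q q. p' \<bullet> frechet_derivative \<phi> (at q) v = p \<bullet> v)))"


section \<open>The rigid body with a generalized rolling constraint\<close>

type_synonym config = "(real^3^3) \<times> (real^3)"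

abbreviation e3 :: "real^3" where "e3 \<equiv> axis 3 1"

definition hat :: "real^3 \<Rightarrow> real^3^3" where
  "hat w = matrix (cross3 w)"

definition vee :: "real^3^3 \<Rightarrow> real^3" where
  "vee X = (THE w. hat w = X)"

definition block_matrix :: "real^2^2 \<Rightarrow> real \<Rightarrow> real^3^3" where
  "block_matrix C d =
     vector [vector [C$1$1, C$1$2, 0],
             vector [C$2$1, C$2$2, 0],
             vector [0, 0, d]]"

definition generalized_rolling :: "real^3^3 \<Rightarrow> bool" where
  "generalized_rolling A \<longleftrightarrow>
     (\<exists>C. rotation_matrix C \<and> A = block_matrix C 1) \<or>
     (\<exists>C. rotation_matrix C \<and> A = block_matrix C 0) \<or>
     A = (\<chi> i j. e3 $ i * e3 $ j) \<or>
     A = 0"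

text \<open>The inertia tensor with diagonal entries \<open>d\<close>.\<close>

definition inertia :: "real^3 \<Rightarrow> real^3^3" where
  "inertia d = (\<chi> i j. if i = j then d $ i else 0)"

definition config_space :: "config set" where
  "config_space = {(g, x). rotation_matrix g}"

text \<open>The left Maurer--Cartan form of \<open>SO(3)\<close>, as a form on \<open>config_space\<close>: \<open>\<Omega> = (g\<^sup>-\<^sup>1 g')\<^sup>\<or>\<close>.\<close>

definition body_velocity :: "config \<Rightarrow> config \<Rightarrow> real^3" where
  "body_velocity q v = vee (matrix_inv (fst q) ** fst v)"

definition lagrangian :: "real^3 \<Rightarrow> real \<Rightarrow> config \<Rightarrow> config \<Rightarrow> real" where
  "lagrangian d m q v =
     (1/2) * ((inertia d *v body_velocity q v) \<bullet> body_velocity q v) + (m/2) * (norm (snd v))\<^sup>2"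

definition constraint_form :: "real \<Rightarrow> real^3^3 \<Rightarrow> config \<Rightarrow> config \<Rightarrow> real^3" where
  "constraint_form r A q v = snd v - r *\<^sub>R (A *v (fst q *v body_velocity q v))"

definition constraint_distribution :: "real \<Rightarrow> real^3^3 \<Rightarrow> config \<Rightarrow> config set" where
  "constraint_distribution r A q = {v \<in> tangent_at config_space q. constraint_form r A q v = 0}"


section \<open>The nonholonomic bracket\<close>

definition constraint_manifold ::
    "real^3 \<Rightarrow> real \<Rightarrow> real \<Rightarrow> real^3^3 \<Rightarrow> (config \<times> config) set" where
  "constraint_manifold d m r A =
     {(q, Legendre config_space (lagrangian d m) q v) | q v.
        q \<in> config_space \<and> v \<in> constraint_distribution r A q}"

definition nh_distribution ::
    "real^3 \<Rightarrow> real \<Rightarrow> real \<Rightarrow> real^3^3 \<Rightarrow> config \<times> config \<Rightarrow> (config \<times> config) set" where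
  "nh_distribution d m r A z =
     {v \<in> tangent_at (constraint_manifold d m r A) z. constraint_form r A (fst z) (fst v) = 0}"

definition nh_vector_field ::
    "real^3 \<Rightarrow> real \<Rightarrow> real \<Rightarrow> real^3^3 \<Rightarrow> (config \<times> config \<Rightarrow> real)
      \<Rightarrow> config \<times> config \<Rightarrow> config \<times> config" where
  "nh_vector_field d m r A f z =
     (THE v. v \<in> nh_distribution d m r A z \<and>
        (\<forall>w\<in>nh_distribution d m r A z.
           canonical_two_form z v w = differential (constraint_manifold d m r A) f z w))"

definition nh_bracket ::
    "real^3 \<Rightarrow> real \<Rightarrow> real \<Rightarrow> real^3^3 \<Rightarrow> (config \<times> config \<Rightarrow> real) \<Rightarrow> (config \<times> config \<Rightarrow> real)
      \<Rightarrow> config \<times> config \<Rightarrow> real" where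
  "nh_bracket d m r A f1 f2 z =
     canonical_two_form z (nh_vector_field d m r A f1 z) (nh_vector_field d m r A f2 z)"


section \<open>Reduction\<close>

definition sym_group :: "((real^3^3) \<times> (real^3)) set" where
  "sym_group = {(h, y). rotation_matrix h \<and> h *v e3 = e3}"

definition action :: "(real^3^3) \<times> (real^3) \<Rightarrow> config \<Rightarrow> config" where
  "action k q = (fst k ** fst q, fst k *v snd q + snd k)"

text \<open>The vector \<open>\<Omega>\<close> at a point \<open>(q, p)\<close> of the constraint manifold.\<close>

definition momentum_to_Omega ::
    "real^3 \<Rightarrow> real \<Rightarrow> real \<Rightarrow> real^3^3 \<Rightarrow> config \<times> config \<Rightarrow> real^3" where
  "momentum_to_Omega d m r A = (\<lambda>(q, p).
     body_velocity q (THE v. v \<in> constraint_distribution r A q \<and>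
       Legendre config_space (lagrangian d m) q v = p))"

definition K_coord :: "real^3 \<Rightarrow> real \<Rightarrow> real \<Rightarrow> real^3^3 \<Rightarrow> config \<times> config \<Rightarrow> real^3" where
  "K_coord d m r A z =
     (let g = fst (fst z); \<Omega> = momentum_to_Omega d m r A z
      in inertia d *v \<Omega> +
         (m * r\<^sup>2) *\<^sub>R (matrix_inv g *v (transpose A *v (A *v (g *v \<Omega>)))))"

definition orbit_projection ::
    "real^3 \<Rightarrow> real \<Rightarrow> real \<Rightarrow> real^3^3 \<Rightarrow> config \<times> config \<Rightarrow> (real^3) \<times> (real^3)" where
  "orbit_projection d m r A z = (matrix_inv (fst (fst z)) *v e3, K_coord d m r A z)"

definition reduced_space :: "((real^3) \<times> (real^3)) set" where
  "reduced_space = {(\<gamma>, K). norm \<gamma> = 1}"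

definition is_reduced_bracket ::
    "real^3 \<Rightarrow> real \<Rightarrow> real \<Rightarrow> real^3^3
      \<Rightarrow> (((real^3) \<times> (real^3) \<Rightarrow> real) \<Rightarrow> ((real^3) \<times> (real^3) \<Rightarrow> real)
           \<Rightarrow> (real^3) \<times> (real^3) \<Rightarrow> real) \<Rightarrow> bool" where
  "is_reduced_bracket d m r A B \<longleftrightarrow>
     (\<forall>f1 \<in> smooth_functions reduced_space. \<forall>f2 \<in> smooth_functions reduced_space.
        \<forall>z \<in> constraint_manifold d m r A.
          B f1 f2 (orbit_projection d m r A z) =
          nh_bracket d m r A (f1 \<circ> orbit_projection d m r A) (f2 \<circ> orbit_projection d m r A) z)"


section \<open>The brackets in redundant coordinates\<close>

text \<open>\<open>\<Omega>\<close> as a function of \<open>(\<gamma>, K)\<close> for rank \<open>j \<in> {0,1,2,3}\<close>.  It is only meant for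
  \<open>norm \<gamma> = 1\<close>; elsewhere the defining equation need not have a unique solution.\<close>

definition K_of_Omega :: "real^3 \<Rightarrow> real \<Rightarrow> real \<Rightarrow> nat \<Rightarrow> real^3 \<Rightarrow> real^3 \<Rightarrow> real^3" where
  "K_of_Omega d m r j \<gamma> \<Omega> =
     (if j = 0 then inertia d *v \<Omega>
      else if j = 1 then inertia d *v \<Omega> + (m * r\<^sup>2 * (\<Omega> \<bullet> \<gamma>)) *\<^sub>R \<gamma>
      else if j = 2 then
        (inertia d + (m * r\<^sup>2) *\<^sub>R mat 1) *v \<Omega> - (m * r\<^sup>2 * (\<Omega> \<bullet> \<gamma>)) *\<^sub>R \<gamma>
      else (inertia d + (m * r\<^sup>2) *\<^sub>R mat 1) *v \<Omega>)"

definition Omega_of :: "real^3 \<Rightarrow> real \<Rightarrow> real \<Rightarrow> nat \<Rightarrow> real^3 \<Rightarrow> real^3 \<Rightarrow> real^3" where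
  "Omega_of d m r j \<gamma> K = (THE \<Omega>. K = K_of_Omega d m r j \<gamma> \<Omega>)"

definition N_vec :: "real^3 \<Rightarrow> real \<Rightarrow> real \<Rightarrow> nat \<Rightarrow> real^3 \<Rightarrow> real^3 \<Rightarrow> real^3" where
  "N_vec d m r j \<gamma> K =
     (let \<Omega> = Omega_of d m r j \<gamma> K in
      if j = 0 then K
      else if j = 1 then K + (m * r\<^sup>2 * (\<Omega> \<bullet> \<gamma>)) *\<^sub>R \<gamma>
      else if j = 2 then K + (m * r\<^sup>2) *\<^sub>R \<Omega> - (m * r\<^sup>2 * (\<Omega> \<bullet> \<gamma>)) *\<^sub>R \<gamma>
      else K + (m * r\<^sup>2) *\<^sub>R \<Omega>)"

definition grad_gamma :: "((real^3) \<times> (real^3) \<Rightarrow> real) \<Rightarrow> (real^3) \<times> (real^3) \<Rightarrow> real^3" where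
  "grad_gamma F y = (\<chi> i. frechet_derivative F (at y) (axis i 1, 0))"

definition grad_K :: "((real^3) \<times> (real^3) \<Rightarrow> real) \<Rightarrow> (real^3) \<times> (real^3) \<Rightarrow> real^3" where
  "grad_K F y = (\<chi> i. frechet_derivative F (at y) (0, axis i 1))"

definition rank_bracket ::
    "real^3 \<Rightarrow> real \<Rightarrow> real \<Rightarrow> nat \<Rightarrow> ((real^3) \<times> (real^3) \<Rightarrow> real) \<Rightarrow> ((real^3) \<times> (real^3) \<Rightarrow> real)
      \<Rightarrow> (real^3) \<times> (real^3) \<Rightarrow> real" where
  "rank_bracket d m r j F1 F2 y =
     - (N_vec d m r j (fst y) (snd y) \<bullet> cross3 (grad_K F1 y) (grad_K F2 y))
     - fst y \<bullet> (cross3 (grad_K F1 y) (grad_gamma F2 y) - cross3 (grad_K F2 y) (grad_gamma F1 y))"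

end

(*
  In the left trivialization a point of the constraint manifold is (g, x, Omega), and a vector of the
  distribution C is determined by the body angular velocity xi of the underlying motion and by
  kappa = dK(v), because gamma moves by gamma x xi and x by r A g xi.  In all four cases A^T A equals
  alpha E + beta e3 e3^T with scalars alpha, beta, so that K = I Omega + m r^2 (alpha Omega + beta (Omega . gamma) gamma)
  and the restricted 2-form becomes
    xi . kappa' - xi' . kappa + N . (xi x xi'),   N = K + m r^2 (alpha Omega + beta (Omega . gamma) gamma).
  Solving i_X Omega_C = df for a function f of (gamma, K) gives
    xi = df/dK,   kappa = N x df/dK + gamma x df/dgamma,
  and inserting two such fields into the 2-form yields the asserted bracket.
*)

theory Submission
  imports Defs
begin

section \<open>Rotations and the hat map\<close>

text \<open>Tangent vectors are given only as velocities of curves, and the Legendre transform,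
  differentials and Hamiltonian fields are definite descriptions. Explicit parametrizations turn
  each of them into a formula, with existence and uniqueness proved each time. The summand \<xi> .
  \<kappa>' - \<xi>' . \<kappa> already makes the form nondegenerate, provided that (\<xi>,
  \<kappa>) ranges over all pairs. This is where positivity of the inertia tensor and of A^T A
  enters: at fixed unit \<gamma>, the linear map from \<Omega> to K is invertible. N differs from K
  because the translational momentum counts once in K but twice in the form: both arguments
  differentiate the moving frame g in it. Using K as coordinate absorbs the remaining terms caused
  by the motion of \<gamma>. Since the resulting expression involves only \<gamma>, K and the
  gradients there, constancy of the bracket on orbits and independence of the chosen extensions are
  read off from it and not proved beforehand.\<close>

declare transpose_matrix_vector [simp del]

lemma hat_mult [simp]: "hat w *v u = cross3 w u"
  unfolding hat_def using bilinear_cross by (simp add: matrix_works bilinear_def)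

lemma hat_nth:  "hat w $1$1 = 0" "hat w $1$2 = - w$3" "hat w $1$3 = w$2"
  "hat w $2$1 = w$3" "hat w $2$2 = 0" "hat w $2$3 = - w$1"
  "hat w $3$1 = - w$2" "hat w $3$2 = w$1" "hat w $3$3 = 0"
  by (simp_all add: hat_def matrix_def cross3_def axis_def)

lemma matrix_mult_nth: "(X ** Y) $ i $ j = X$i$1 * Y$1$j + X$i$2 * Y$2$j + X$i$3 * Y$3$j" for X Y :: "real^3^3"
  by (simp add: matrix_matrix_mult_def sum_3)

lemma linear_hat: "linear hat"
  by (intro linearI) (simp_all add: matrix_eq matrix_vector_mult_add_rdistrib cross_add_left cross_mult_left
    flip: scaleR_matrix_vector_assoc)

lemma transpose_hat: "transpose (hat w) = - hat w"
  by (simp add: hat_nth transpose_def vec_eq_iff forall_3)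

text \<open>Linear on all matrices, so it can be differentiated along curves, whereas
  \<open>vee\<close> is a definite description that is meaningful on skew matrices only.\<close>

definition unhat :: "real^3^3 \<Rightarrow> real^3" where
  "unhat X = vector [X$3$2, X$1$3, X$2$1]"

lemma linear_unhat: "linear unhat"
  by (intro linearI) (simp_all add: unhat_def vec_eq_iff forall_3)

lemma unhat_hat [simp]: "unhat (hat w) = w"
  by (simp add: unhat_def hat_nth vec_eq_iff forall_3)

lemma hat_eq_iff [simp]: "hat v = hat w \<longleftrightarrow> v = w"
  by (metis unhat_hat)

lemma vee_hat [simp]: "vee (hat w) = w"
  by (simp add: vee_def)

lemma hat_unhat:
  assumes "transpose X = - X" shows "hat (unhat X) = X"
proof -
  have "X$j$i = - X$i$j" for i j
    using arg_cong[OF assms, of "\<lambda>Y. Y $ i $ j"] by (simp add: transpose_def)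
  from this[of 1 1] this[of 2 2] this[of 3 3] this[of 1 2] this[of 1 3] this[of 2 3]
  have "X$1$1 = 0" "X$2$2 = 0" "X$3$3 = 0" "X$2$1 = - X$1$2" "X$3$1 = - X$1$3" "X$3$2 = - X$2$3"
    by linarith+
  then show ?thesis
    unfolding vec_eq_iff forall_3 by (simp add: hat_nth unhat_def)
qed

lemma inner_hat: "hat v \<bullet> hat w = 2 * (v \<bullet> w)"
  by (simp add: hat_nth inner_vec_def sum_3)

text \<open>The left side is -tr([U, V] W) for the hat matrices U, V, W, and the commutator [U, V]
  is the hat of \<open>cross3 u v\<close>. This produces the inertial part of N.\<close>

lemma inner_hat_commutator:
  "hat u \<bullet> (hat v ** hat w) - hat v \<bullet> (hat u ** hat w) = 2 * (cross3 u v \<bullet> w)"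
  by (simp add: hat_nth matrix_mult_nth inner_vec_def sum_3 cross_components) algebra

section \<open>Rotations as isometries of vectors and matrices\<close>

lemma inner_matrix_columns:
  fixes X Y :: "real^'n^'m"
  shows "X \<bullet> Y = (\<Sum>j\<in>UNIV. (X *v axis j 1) \<bullet> (Y *v axis j 1))"
proof -
  have "X \<bullet> Y = (\<Sum>i\<in>UNIV. \<Sum>j\<in>UNIV. X$i$j * Y$i$j)"
    by (simp add: inner_vec_def)
  also have "\<dots> = (\<Sum>j\<in>UNIV. \<Sum>i\<in>UNIV. X$i$j * Y$i$j)"
    by (rule sum.swap)
  finally show ?thesis
    by (simp add: matrix_vector_mult_basis column_def inner_vec_def)
qed

lemma transpose_inner:
  fixes A :: "real^'n^'m"
  shows "(A *v v) \<bullet> w = v \<bullet> (transpose A *v w)"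
  by (simp add: transpose_matrix_vector dot_lmul_matrix inner_commute[of v] inner_commute[of w])

lemma orthogonal_matrix_mult_inner:
  fixes g :: "real^'n^'n"
  assumes "orthogonal_matrix g"
  shows "(g *v v) \<bullet> (g *v w) = v \<bullet> w"
  using assms by (simp add: transpose_inner matrix_vector_mul_assoc orthogonal_matrix_def)

lemma orthogonal_matrix_mult_inner_matrix:
  fixes g :: "real^'n^'n"
  assumes "orthogonal_matrix g"
  shows "(g ** X) \<bullet> (g ** Y) = X \<bullet> Y"
  by (simp add: inner_matrix_columns orthogonal_matrix_mult_inner[OF assms] flip: matrix_vector_mul_assoc)

lemma rotation_matrixD:
  fixes g :: "real^'n^'n"
  assumes "rotation_matrix g"
  shows "orthogonal_matrix g" "transpose g ** g = mat 1" "g ** transpose g = mat 1" "det g = 1"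
  using assms by (auto simp: rotation_matrix_def orthogonal_matrix_def)

lemma matrix_inv_rotation:
  fixes g :: "real^'n^'n"
  assumes "rotation_matrix g" shows "matrix_inv g = transpose g"
proof -
  have "g ** matrix_inv g = mat 1 \<and> matrix_inv g ** g = mat 1"
    unfolding matrix_inv_def by (rule someI[of _ "transpose g"]) (simp add: rotation_matrixD[OF assms])
  then have "matrix_inv g ** (g ** transpose g) = transpose g"
    by (simp add: matrix_mul_assoc)
  then show ?thesis
    by (simp add: rotation_matrixD[OF assms])
qed

lemma rotation_matrix_mult:
  fixes g h :: "real^'n^'n"
  assumes "rotation_matrix g" "rotation_matrix h" shows "rotation_matrix (g ** h)"
  using assms by (simp add: rotation_matrix_def orthogonal_matrix_mul det_mul)

lemma rotation_matrix_transpose: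
  fixes g :: "real^'n^'n"
  assumes "rotation_matrix g" shows "rotation_matrix (transpose g)"
  using assms by (simp add: rotation_matrix_def)

section \<open>Differentiation of matrix-valued curves\<close>

lemma bounded_bilinear_matrix_mult:
  "bounded_bilinear ((**) :: real^'n^'m \<Rightarrow> real^'k^'n \<Rightarrow> real^'k^'m)"
  unfolding bilinear_conv_bounded_bilinear[symmetric] bilinear_def
  by (intro allI conjI linearI)
     (simp_all add: matrix_add_ldistrib vec_eq_iff matrix_matrix_mult_def sum.distrib sum_distrib_left algebra_simps)

lemma bounded_bilinear_matrix_vector_mult:
  "bounded_bilinear ((*v) :: real^'n^'m \<Rightarrow> real^'n \<Rightarrow> real^'m)"
  unfolding bilinear_conv_bounded_bilinear[symmetric] bilinear_def
  by (intro allI conjI linearI)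
    (simp_all add: algebra_simps flip: scaleR_matrix_vector_assoc)

lemma bounded_linear_transpose: "bounded_linear (transpose :: real^'n^'m \<Rightarrow> real^'m^'n)"
  unfolding linear_conv_bounded_linear[symmetric]
  by (intro linearI) (simp_all add: transpose_def vec_eq_iff)

lemmas bounded_linear_hat = linear_hat[unfolded linear_conv_bounded_linear]
  and bounded_linear_unhat = linear_unhat[unfolded linear_conv_bounded_linear]

lemmas matrix_derivative_intros =
  bounded_bilinear.has_vector_derivative[OF bounded_bilinear_matrix_mult]
  bounded_bilinear.has_vector_derivative[OF bounded_bilinear_matrix_vector_mult]
  bounded_linear.has_vector_derivative[OF bounded_linear_transpose]
  bounded_linear.has_vector_derivative[OF bounded_linear_hat]
  bounded_linear.has_vector_derivative[OF bounded_linear_unhat]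
  bounded_linear.has_vector_derivative[OF matrix_vector_mul_bounded_linear]
  bounded_linear.has_vector_derivative[OF bounded_linear_fst]
  bounded_linear.has_vector_derivative[OF bounded_linear_snd]

text \<open>As the cube of \<open>hat w\<close> is -(w . w) \<open>hat w\<close>, orthogonality
  fails only by a multiple of \<open>hat w ** hat w\<close>; the hypothesis makes its coefficient
  vanish, and the same factor occurs in the determinant. Coefficients s and c rational in t then
  give curves of rotations without the matrix exponential.\<close>

lemma rotation_matrix_hat:
  assumes "s\<^sup>2 + c\<^sup>2 * (w \<bullet> w) = 2 * c"
  shows "rotation_matrix (mat 1 + s *\<^sub>R hat w + c *\<^sub>R (hat w ** hat w))"
proof -
  let ?R = "mat 1 + s *\<^sub>R hat w + c *\<^sub>R (hat w ** hat w)"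
  have "det ?R = 1 + (w \<bullet> w) * (s\<^sup>2 + c\<^sup>2 * (w \<bullet> w) - 2 * c)"
    by (simp add: det_3 hat_nth matrix_mult_nth inner_vec_def sum_3 mat_def) algebra
  moreover have "transpose ?R ** ?R = mat 1 - (s\<^sup>2 + c\<^sup>2 * (w \<bullet> w) - 2 * c) *\<^sub>R (hat w ** hat w)"
    unfolding vec_eq_iff forall_3
    by (simp add: hat_nth matrix_mult_nth inner_vec_def sum_3 mat_def transpose_def; intro conjI; algebra)
  ultimately show ?thesis
    using assms by (simp add: rotation_matrix_def orthogonal_matrix)
qed

text \<open>The Cayley transform \<open>(1 + X/2) (1 - X/2)\<^sup>-\<^sup>1\<close> of \<open>X = t hat w\<close>, made explicit with
  \<open>X\<^sup>3 = -t\<^sup>2 (w \<bullet> w) X\<close>.\<close>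

definition cayley_curve :: "real^3 \<Rightarrow> real \<Rightarrow> real^3^3" where
  "cayley_curve w t = mat 1 + (4 * t / (4 + t\<^sup>2 * (w \<bullet> w))) *\<^sub>R hat w
     + (2 * t\<^sup>2 / (4 + t\<^sup>2 * (w \<bullet> w))) *\<^sub>R (hat w ** hat w)"

lemma rotation_matrix_cayley_curve: "rotation_matrix (cayley_curve w t)"
proof -
  let ?n = "w \<bullet> w"
  define q where "q = 4 + t\<^sup>2 * ?n"
  have q: "q > 0"
    unfolding q_def by (smt (verit) inner_ge_zero zero_le_mult_iff zero_le_power2)
  have "(4 * t / q)\<^sup>2 + (2 * t\<^sup>2 / q)\<^sup>2 * ?n = (16 * t\<^sup>2 + 4 * t ^ 4 * ?n) / q\<^sup>2"
    by (simp add: power_divide power_mult_distrib add_divide_distrib)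
  also have "16 * t\<^sup>2 + 4 * t ^ 4 * ?n = 4 * t\<^sup>2 * q"
    unfolding q_def by algebra
  also have "4 * t\<^sup>2 * q / q\<^sup>2 = 2 * (2 * t\<^sup>2 / q)"
    using q by (simp add: power2_eq_square)
  finally show ?thesis
    unfolding cayley_curve_def q_def[symmetric] by (rule rotation_matrix_hat)
qed

lemma cayley_curve_0 [simp]: "cayley_curve w 0 = mat 1"
  by (simp add: cayley_curve_def)

lemma cayley_curve_derivative: "(cayley_curve w has_vector_derivative hat w) (at 0)"
proof -
  have s: "((\<lambda>t. 4 * t / (4 + t\<^sup>2 * (w \<bullet> w))) has_real_derivative 1) (at 0)"
    by (auto intro!: derivative_eq_intros)
  have c: "((\<lambda>t. 2 * t\<^sup>2 / (4 + t\<^sup>2 * (w \<bullet> w))) has_real_derivative 0) (at 0)"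
    by (auto intro!: derivative_eq_intros)
  note has_vector_derivative_scaleR[OF s has_vector_derivative_const[of "hat w"]]
    and has_vector_derivative_scaleR[OF c has_vector_derivative_const[of "hat w ** hat w"]]
  from has_vector_derivative_add[OF has_vector_derivative_add[OF has_vector_derivative_const[of "mat 1"] this(1)] this(2)]
  show ?thesis
    unfolding cayley_curve_def[abs_def] by simp
qed

section \<open>Tangent vectors and Legendre transform of the configuration space\<close>

lemma inertia_mult_nth [simp]: "(inertia d *v v) $ i = d $ i * v $ i"
  by (simp add: inertia_def matrix_vector_mult_def if_distrib if_distribR cong: if_cong)

lemma inertia_symmetric: "(inertia d *v v) \<bullet> w = v \<bullet> (inertia d *v w)"
  by (simp add: inner_vec_def mult_ac)

text \<open>The one-sided bound fits a vanishing sum from which a nonnegative constraint term has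
  been dropped.\<close>

lemma inertia_eq_0: 
  assumes "\<forall>i. d $ i > 0" "(inertia d *v v) \<bullet> v \<le> 0" shows "v = 0"
proof -
  have *: "\<forall>i\<in>UNIV. d $ i * (v $ i * v $ i) \<ge> 0"
    using assms(1) by (simp add: less_imp_le)
  have "(\<Sum>i\<in>UNIV. d $ i * (v $ i * v $ i)) = 0"
    using assms(2) * by (simp add: inner_vec_def mult.assoc order_antisym sum_nonneg)
  then have "\<forall>i\<in>UNIV. d $ i * (v $ i * v $ i) = 0"
    using * by (subst (asm) sum_nonneg_eq_0_iff) auto
  then show ?thesis
    using assms(1) by (metis less_irrefl mult_eq_0_iff UNIV_I vec_eq_iff zero_index)
qed

lemma inertia_inverse:
  assumes "\<forall>i. d $ i > 0" shows "inertia (\<chi> i. inverse (d $ i)) *v (inertia d *v v) = v"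
  using assms by (simp add: vec_eq_iff less_imp_neq[symmetric] flip: mult.assoc)

text \<open>Differentiating \<open>transpose (G t) ** G t = mat 1\<close> makes
  \<open>transpose (G 0) ** D\<close> skew, hence a hat matrix.\<close>

lemma rotation_curve_velocity:
  assumes "\<And>t. rotation_matrix (G t)" "(G has_vector_derivative D) (at 0)"
  obtains w where "D = G 0 ** hat w"
proof -
  have "((\<lambda>t. transpose (G t) ** G t) has_vector_derivative
      transpose (G 0) ** D + transpose D ** G 0) (at 0)"
    by (intro matrix_derivative_intros assms)
  moreover have "(\<lambda>t. transpose (G t) ** G t) = (\<lambda>t. mat 1)"
    using rotation_matrixD(2) assms(1) by blast
  ultimately have "transpose (G 0) ** D + transpose D ** G 0 = 0"
    by (metis has_vector_derivative_const vector_derivative_unique_at)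
  then have "transpose (transpose (G 0) ** D) = - (transpose (G 0) ** D)"
    by (simp add: matrix_transpose_mul eq_neg_iff_add_eq_0 add.commute)
  then have "G 0 ** hat (unhat (transpose (G 0) ** D)) = D"
    using assms(1)[of 0] by (simp add: hat_unhat matrix_mul_assoc rotation_matrixD)
  then show ?thesis by (metis that)
qed

lemma rotation_curve_exists:
  assumes "rotation_matrix g"
  obtains G where "\<And>t. rotation_matrix (G t)" "G 0 = g" "(G has_vector_derivative g ** hat w) (at 0)"
proof
  show "rotation_matrix (g ** cayley_curve w t)" for t
    by (intro rotation_matrix_mult assms rotation_matrix_cayley_curve)
  show "((\<lambda>t. g ** cayley_curve w t) has_vector_derivative g ** hat w) (at 0)"
    using bounded_bilinear.has_vector_derivative[OF bounded_bilinear_matrix_mult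
      has_vector_derivative_const cayley_curve_derivative, of g w] 
    by (simp add: bounded_bilinear.zero_left[OF bounded_bilinear_matrix_mult])
qed simp

lemma has_vector_derivative_line: "((\<lambda>t. x + t *\<^sub>R u) has_vector_derivative u) (at 0)"
  by (auto intro!: derivative_eq_intros)

lemma tangent_config_space:
  assumes g: "rotation_matrix g"
  shows "tangent_at config_space (g, x) = {(g ** hat w, u) | w u. True}"
proof (intro equalityI subsetI)
  fix v assume "v \<in> tangent_at config_space (g, x)"
  then obtain c where c: "c 0 = (g, x)" "\<And>t. c t \<in> config_space" "(c has_vector_derivative v) (at 0)"
    by (auto simp: tangent_at_def has_velocity_def)
  have "rotation_matrix (fst (c t))" for t
    using c(2)[of t] by (auto simp: config_space_def)
  then obtain w where "fst v = fst (c 0) ** hat w"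
    using rotation_curve_velocity[of "\<lambda>t. fst (c t)" "fst v"] c(3) by (auto intro: matrix_derivative_intros)
  then show "v \<in> {(g ** hat w, u) | w u. True}"
    by (cases v) (auto simp: c)
next
  fix v :: config assume "v \<in> {(g ** hat w, u) | w u. True}"
  then obtain w u where v: "v = (g ** hat w, u)" by blast
  obtain G where G: "\<And>t. rotation_matrix (G t)" "G 0 = g" "(G has_vector_derivative g ** hat w) (at 0)"
    using rotation_curve_exists[OF g] by metis
  have "has_velocity config_space (g, x) v (\<lambda>t. (G t, x + t *\<^sub>R u))"
    unfolding has_velocity_def v
    using G by (auto simp: config_space_def intro!: has_vector_derivative_Pair has_vector_derivative_line)
  then show "v \<in> tangent_at config_space (g, x)"
    by (auto simp: tangent_at_def)
qed

lemma rotation_cancel: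
  fixes g :: "real^'n^'n"
  assumes "rotation_matrix g"
  shows "transpose g ** (g ** X) = X" "g ** (transpose g ** X) = X"
    "transpose g *v (g *v v) = v" "g *v (transpose g *v v) = v"
  using rotation_matrixD[OF assms] by (simp_all add: matrix_mul_assoc matrix_vector_mul_assoc)

lemma transpose_fixes_e3:
  assumes "rotation_matrix h" "h *v e3 = e3" shows "transpose h *v e3 = e3"
  using rotation_cancel(3)[OF assms(1), of e3] assms(2) by simp

lemma rotation_left_cancel:
  fixes g :: "real^'n^'n"
  assumes "rotation_matrix g"
  shows "g ** X = g ** Y \<longleftrightarrow> X = Y"
proof
  assume "g ** X = g ** Y"
  then have "transpose g ** (g ** X) = transpose g ** (g ** Y)" by simp
  then show "X = Y" unfolding rotation_cancel[OF assms] .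
qed simp

lemma body_velocity_config [simp]:
  assumes "rotation_matrix g"
  shows "body_velocity (g, x) (g ** hat w, u) = w"
  by (simp add: body_velocity_def matrix_inv_rotation assms rotation_cancel)

lemma inner_tangent_config:
  assumes "rotation_matrix g"
  shows "(g ** hat v, u) \<bullet> (g ** hat w, u') = 2 * (v \<bullet> w) + u \<bullet> u'"
  by (simp add: orthogonal_matrix_mult_inner_matrix rotation_matrixD assms inner_hat)

text \<open>The difference p - q is itself tangent and can serve as the test vector. This settles
  uniqueness in \<open>Legendre\<close> and \<open>cotangent_lift\<close>.\<close>

lemma tangent_config_eqI:
  assumes "rotation_matrix g" "p \<in> tangent_at config_space (g, x)" "q \<in> tangent_at config_space (g, x)"
    and "\<And>w. w \<in> tangent_at config_space (g, x) \<Longrightarrow> p \<bullet> w = q \<bullet> w"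
  shows "p = q"
proof -
  obtain a b a' b' where pq: "p = (g ** hat a, b)" "q = (g ** hat a', b')"
    using assms by (auto simp: tangent_config_space)
  have "p - q = (g ** hat (a - a'), b - b')"
    by (simp add: pq linear_diff[OF linear_hat] matrix_eq matrix_vector_mult_diff_rdistrib matrix_vector_mult_diff_distrib
        cross3_def algebra_simps flip: matrix_vector_mul_assoc)
  then have "p - q \<in> tangent_at config_space (g, x)"
    using assms(1) by (auto simp: tangent_config_space)
  with assms(4) have "(p - q) \<bullet> (p - q) = 0"
    by (simp add: inner_diff_left)
  then show ?thesis by simp
qed

lemma matrix_hat_linear:
  "g ** hat v + t *\<^sub>R (g ** hat w) = g ** hat (v + t *\<^sub>R w)"
  by (simp add: linear_add[OF linear_hat] linear_scale[OF linear_hat] matrix_add_ldistrib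
     bounded_bilinear.scaleR_right[OF bounded_bilinear_matrix_mult])

section \<open>Legendre transform, constraint distribution and canonical form\<close>

lemma lagrangian_derivative:
  assumes g: "rotation_matrix g"
  shows "((\<lambda>t. lagrangian d m (g, x) ((g ** hat w, u) + t *\<^sub>R (g ** hat w', u'))) has_real_derivative
    (g ** hat ((1/2) *\<^sub>R (inertia d *v w)), m *\<^sub>R u) \<bullet> (g ** hat w', u')) (at 0)"
proof -
  \<comment> \<open>The Lagrangian is quadratic on each tangent space, so this expansion is exact
    and the derivative is its coefficient of t; symmetry of the inertia tensor merges the two cross
    terms.\<close>
  have "lagrangian d m (g, x) ((g ** hat w, u) + t *\<^sub>R (g ** hat w', u')) =
      (1/2) * ((inertia d *v w) \<bullet> w) + (m/2) * (u \<bullet> u)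
      + t * ((inertia d *v w) \<bullet> w' + m * (u \<bullet> u'))
      + t\<^sup>2 * ((1/2) * ((inertia d *v w') \<bullet> w') + (m/2) * (u' \<bullet> u'))" for t
  proof -
    have "lagrangian d m (g, x) ((g ** hat w, u) + t *\<^sub>R (g ** hat w', u')) =
      (1/2) * ((inertia d *v (w + t *\<^sub>R w')) \<bullet> (w + t *\<^sub>R w')) + (m/2) * ((u + t *\<^sub>R u') \<bullet> (u + t *\<^sub>R u'))"
      by (simp add: lagrangian_def matrix_hat_linear g power2_norm_eq_inner)
    moreover have "(inertia d *v w') \<bullet> w = (inertia d *v w) \<bullet> w'"
      by (metis inertia_symmetric inner_commute)
    ultimately show ?thesis
      by (simp add: matrix_vector_right_distrib matrix_vector_mult_scaleR inner_add_left inner_add_right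
        inner_commute[of u' u] algebra_simps power2_eq_square)
  qed
  then show ?thesis
    by (auto intro!: derivative_eq_intros simp: inner_tangent_config[OF g] simp del: inner_Pair)
qed

lemma Legendre_config:
  assumes g: "rotation_matrix g"
  shows "Legendre config_space (lagrangian d m) (g, x) (g ** hat w, u) =
    (g ** hat ((1/2) *\<^sub>R (inertia d *v w)), m *\<^sub>R u)"
  unfolding Legendre_def
proof (rule the_equality)
  let ?p = "(g ** hat ((1/2) *\<^sub>R (inertia d *v w)), m *\<^sub>R u)"
  let ?T = "tangent_at config_space (g, x)"
  have p: "?p \<in> ?T" by (auto simp: tangent_config_space g)
  have deriv: "((\<lambda>t. lagrangian d m (g, x) ((g ** hat w, u) + t *\<^sub>R v)) has_real_derivative ?p \<bullet> v) (at 0)" 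
    if "v \<in> ?T" for v
    using that lagrangian_derivative[OF g] by (auto simp: tangent_config_space g simp del: inner_Pair)
  then show "?p \<in> ?T \<and> (\<forall>v\<in>?T. ((\<lambda>t. lagrangian d m (g, x) ((g ** hat w, u) + t *\<^sub>R v))
      has_real_derivative ?p \<bullet> v) (at 0))"
    using p by blast
  show "q = ?p" if "q \<in> ?T \<and> (\<forall>v\<in>?T. ((\<lambda>t. lagrangian d m (g, x) ((g ** hat w, u) + t *\<^sub>R v))
      has_real_derivative q \<bullet> v) (at 0))" for q
    using that p by (intro tangent_config_eqI[OF g]) (blast intro: DERIV_unique deriv)+
qed

lemma constraint_form_config:
  assumes "rotation_matrix g"
  shows "constraint_form r A (g, x) (g ** hat w, u) = u - r *\<^sub>R (A *v (g *v w))"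
  by (simp add: constraint_form_def assms)

lemma constraint_distribution_config:
  assumes "rotation_matrix g"
  shows "constraint_distribution r A (g, x) = {(g ** hat w, r *\<^sub>R (A *v (g *v w))) | w. True}"
  by (auto simp: constraint_distribution_def tangent_config_space constraint_form_config assms)

lemma canonical_two_form_eq:
  "canonical_two_form z u v = fst u \<bullet> snd v - fst v \<bullet> snd u" for z u v :: "'a::euclidean_space \<times> 'a"
proof -
  have "frechet_derivative (\<lambda>y::'a \<times> 'a. canonical_one_form y v) (at z) = (\<lambda>u. snd u \<bullet> fst v)" for v
    unfolding canonical_one_form_def
    by (rule frechet_derivative_at[symmetric]) (auto intro!: derivative_eq_intros)
  then show ?thesis
    by (simp add: canonical_two_form_def exterior_derivative_def inner_commute)
qed

section \<open>Smooth functions along curves\<close>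

lemma linear_functional_expansion:
  fixes f :: "real^'n \<Rightarrow> real"
  assumes "linear f"
  shows "f v = (\<Sum>i\<in>UNIV. v $ i * f (axis i 1))"
proof -
  have "f v = f (\<Sum>i\<in>UNIV. v $ i *\<^sub>R axis i 1)"
    by (simp add: basis_expansion flip: scalar_mult_eq_scaleR)
  also have "\<dots> = (\<Sum>i\<in>UNIV. v $ i * f (axis i 1))"
    by (simp add: linear_sum[OF assms] linear_scale[OF assms])
  finally show ?thesis .
qed

lemma frechet_derivative_gradients:
  assumes "F differentiable (at y)"
  shows "frechet_derivative F (at y) (v, w) = grad_gamma F y \<bullet> v + grad_K F y \<bullet> w"
proof -
  let ?L = "frechet_derivative F (at y)"
  have L: "linear ?L"
    using assms by (rule linear_frechet_derivative)
  have "?L (v, w) = ?L (v, 0) + ?L (0, w)"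
    using linear_add[OF L, of "(v, 0)" "(0, w)"] by simp
  also have "?L (v, 0) = grad_gamma F y \<bullet> v"
  proof -
    have "linear (\<lambda>v. ?L (v, 0))"
      using linear_compose[OF _ L, of "\<lambda>v. (v, 0)"] by (simp add: o_def linear_iff)
    then have "?L (v, 0) = (\<Sum>i\<in>UNIV. v $ i * ?L (axis i 1, 0))"
      by (rule linear_functional_expansion)
    then show ?thesis
      by (simp add: grad_gamma_def inner_vec_def mult.commute)
  qed
  also have "?L (0, w) = grad_K F y \<bullet> w"
  proof -
    have "linear (\<lambda>v. ?L (0, v))"
      using linear_compose[OF _ L, of "\<lambda>v. (0, v)"] by (simp add: o_def linear_iff)
    then have "?L (0, w) = (\<Sum>i\<in>UNIV. w $ i * ?L (0, axis i 1))"
      by (rule linear_functional_expansion)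
    then show ?thesis
      by (simp add: grad_K_def inner_vec_def mult.commute)
  qed
  finally show ?thesis .
qed

lemma smooth_on_open_differentiable:
  "smooth_on_open U F \<Longrightarrow> y \<in> U \<Longrightarrow> F differentiable (at y)"
  unfolding smooth_on_open_def using Ck_on.simps(2)[of 0] by blast

text \<open>Only the extension F can be differentiated. By continuity the curve stays in U near time
  0, and there F and f agree along it.\<close>

lemma smooth_extension_chain:
  fixes c :: "real \<Rightarrow> 'a::euclidean_space"
  assumes F: "smooth_on_open U F" "c 0 \<in> U" "\<And>y. y \<in> U \<inter> S \<Longrightarrow> F y = f y"
    and c: "\<And>t. c t \<in> S" "(c has_vector_derivative v) (at 0)"
  shows "((\<lambda>t. f (c t)) has_real_derivative frechet_derivative F (at (c 0)) v) (at 0)"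
proof -
  have "(F has_derivative frechet_derivative F (at (c 0))) (at (c 0))"
    using smooth_on_open_differentiable[OF F(1,2)] frechet_derivative_works by blast
  with c(2) have deriv: "((F \<circ> c) has_vector_derivative frechet_derivative F (at (c 0)) v) (at 0)"
    by (rule vector_derivative_diff_chain_within[OF _ has_derivative_at_withinI])
  have "eventually (\<lambda>t. c t \<in> U) (at 0)"
  proof (rule topological_tendstoD)
    show "c \<midarrow>0\<rightarrow> c 0"
      using has_vector_derivative_continuous[OF c(2)] by (simp add: isCont_def)
  qed (use F(1,2) in \<open>auto simp: smooth_on_open_def\<close>)
  then have "eventually (\<lambda>t. (F \<circ> c) t = f (c t)) (at 0)"
    by eventually_elim (simp add: F(3) c(1))
  moreover have "(F \<circ> c) 0 = f (c 0)"
    using F(2,3) c(1) by simp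
  ultimately have "eventually (\<lambda>t. t \<in> UNIV \<longrightarrow> (F \<circ> c) t = f (c t)) (nhds 0)"
    by (simp add: eventually_nhds_conv_at)
  from has_vector_derivative_cong_ev[OF this] F c deriv show ?thesis
    unfolding has_real_derivative_iff_has_vector_derivative by (simp add: o_def)
qed

text \<open>Tangency of v supplies a curve, and a single curve pins down the value in the definite
  description.\<close>

lemma differential_eqI:
  assumes "v \<in> tangent_at S x"
    and "\<And>c. has_velocity S x v c \<Longrightarrow> ((\<lambda>t. f (c t)) has_real_derivative D) (at 0)"
  shows "differential S f x v = D"
  unfolding differential_def using assms by (intro the_equality) (auto simp: tangent_at_def dest: DERIV_unique)

section \<open>The constraint manifold\<close>

text \<open>The constraint matrix enters only through the two scalars in \<open>A\<^sup>T A = \<alpha> E + \<beta> e\<^sub>3 e\<^sub>3\<^sup>T\<close> and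
  through commuting with the rotations about \<open>e\<^sub>3\<close>; \<open>(\<alpha>, \<beta>)\<close> is \<open>(0, 0)\<close>, \<open>(0, 1)\<close>, \<open>(1, -1)\<close>, \<open>(1, 0)\<close>
  for rank 0, 1, 2, 3.\<close>

locale rolling_body =
  fixes d :: "real^3" and m r :: real and A :: "real^3^3" and j :: nat and \<alpha> \<beta> :: real
  assumes m_pos: "m > 0" and d_pos: "\<forall>i. d $ i > 0"
    and \<alpha>_nonneg: "\<alpha> \<ge> 0" and \<alpha>_plus_\<beta>_nonneg: "\<alpha> + \<beta> \<ge> 0"
    and gram: "transpose A *v (A *v w) = \<alpha> *\<^sub>R w + (\<beta> * (w \<bullet> e3)) *\<^sub>R e3"
    and commute: "rotation_matrix h \<Longrightarrow> h *v e3 = e3 \<Longrightarrow> A *v (h *v v) = h *v (A *v v)"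
    and K_eq: "K_of_Omega d m r j \<gamma> w =
      inertia d *v w + (m * r\<^sup>2) *\<^sub>R (\<alpha> *\<^sub>R w + (\<beta> * (w \<bullet> \<gamma>)) *\<^sub>R \<gamma>)"
    and N_eq: "N_vec d m r j \<gamma> K =
      K + (m * r\<^sup>2) *\<^sub>R (\<alpha> *\<^sub>R Omega_of d m r j \<gamma> K + (\<beta> * (Omega_of d m r j \<gamma> K \<bullet> \<gamma>)) *\<^sub>R \<gamma>)"
begin

abbreviation "Kmap \<equiv> K_of_Omega d m r j"

section \<open>Invertibility of the map from angular velocity to K\<close>

lemma linear_Kmap: "linear (Kmap \<gamma>)"
  by (intro linearI) (simp_all add: K_eq inner_add_left algebra_simps)

lemma Kmap_eq_0:
  assumes "norm \<gamma> = 1" "Kmap \<gamma> w = 0" shows "w = 0"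
proof -
  have "(w \<bullet> \<gamma>)\<^sup>2 \<le> w \<bullet> w"
    using Cauchy_Schwarz_ineq[of w \<gamma>] assms(1) by (simp add: norm_eq_1)
  \<comment> \<open>\<alpha> and \<alpha> + \<beta> weigh the parts of w orthogonal and parallel to
    the unit vector \<gamma>; this is positive semidefiniteness of A^T A.\<close>
  then have "0 \<le> \<alpha> * (w \<bullet> w - (w \<bullet> \<gamma>)\<^sup>2) + (\<alpha> + \<beta>) * (w \<bullet> \<gamma>)\<^sup>2"
    using \<alpha>_nonneg \<alpha>_plus_\<beta>_nonneg by simp
  also have "\<dots> = \<alpha> * (w \<bullet> w) + \<beta> * (w \<bullet> \<gamma>)\<^sup>2"
    by (simp add: algebra_simps)
  finally have *: "0 \<le> (m * r\<^sup>2) * (\<alpha> * (w \<bullet> w) + \<beta> * (w \<bullet> \<gamma>)\<^sup>2)"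
    using m_pos by simp
  have "0 = Kmap \<gamma> w \<bullet> w"
    using assms(2) by simp
  also have "\<dots> = (inertia d *v w) \<bullet> w + (m * r\<^sup>2) * (\<alpha> * (w \<bullet> w) + \<beta> * (w \<bullet> \<gamma>)\<^sup>2)"
    by (simp add: K_eq inner_add_left power2_eq_square inner_commute[of \<gamma>])
  finally show ?thesis
    using inertia_eq_0[OF d_pos] * by simp
qed

lemma bij_Kmap:
  assumes "norm \<gamma> = 1" shows "bij (Kmap \<gamma>)"
proof -
  have "inj (Kmap \<gamma>)"
    using Kmap_eq_0[OF assms] by (simp add: linear_injective_0 linear_Kmap)
  then show ?thesis
    by (simp add: bij_def linear_Kmap linear_injective_imp_surjective)
qed

lemma Omega_of_Kmap [simp]:
  assumes "norm \<gamma> = 1" shows "Omega_of d m r j \<gamma> (Kmap \<gamma> w) = w"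
  unfolding Omega_of_def using bij_Kmap[OF assms] by (auto simp: bij_def inj_def)

lemma Kmap_Omega_of [simp]:
  assumes "norm \<gamma> = 1" shows "Kmap \<gamma> (Omega_of d m r j \<gamma> K) = K"
  using bij_Kmap[OF assms] Omega_of_Kmap[OF assms] by (metis bij_pointE)

text \<open>The factor \<open>1/2\<close> compensates that the ambient inner product of \<open>hat v\<close> and \<open>hat w\<close> is
  \<open>2 (v \<bullet> w)\<close>.\<close>

definition chart :: "real^3^3 \<Rightarrow> real^3 \<Rightarrow> real^3 \<Rightarrow> config \<times> config" where
  "chart g x w = ((g, x), (g ** hat ((1/2) *\<^sub>R (inertia d *v w)), (m * r) *\<^sub>R (A *v (g *v w))))"

lemma constraint_manifold_eq:
  "constraint_manifold d m r A = {chart g x w | g x w. rotation_matrix g}"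
proof (intro equalityI subsetI)
  fix z assume "z \<in> constraint_manifold d m r A"
  then obtain g x w where "rotation_matrix g"
    "z = ((g, x), Legendre config_space (lagrangian d m) (g, x) (g ** hat w, r *\<^sub>R (A *v (g *v w))))"
    by (auto simp: constraint_manifold_def config_space_def constraint_distribution_config)
  then show "z \<in> {chart g x w | g x w. rotation_matrix g}"
    by (auto simp: Legendre_config chart_def)
next
  fix z assume "z \<in> {chart g x w | g x w. rotation_matrix g}"
  then obtain g x w where g: "rotation_matrix g" and z: "z = chart g x w" by blast
  have "z = ((g, x), Legendre config_space (lagrangian d m) (g, x) (g ** hat w, r *\<^sub>R (A *v (g *v w))))"
    by (simp add: z g Legendre_config chart_def)
  then show "z \<in> constraint_manifold d m r A"
    using g unfolding constraint_manifold_def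
    by (intro CollectI exI conjI) (auto simp: config_space_def constraint_distribution_config)
qed

lemma chart_in_manifold [simp]: "rotation_matrix g \<Longrightarrow> chart g x w \<in> constraint_manifold d m r A"
  by (auto simp: constraint_manifold_eq)

text \<open>Recovers \<open>\<Omega>\<close> from the momentum by a formula that can be differentiated along curves.\<close>

definition body_of :: "config \<times> config \<Rightarrow> real^3" where
  "body_of z = inertia (\<chi> i. inverse (d $ i)) *v (2 *\<^sub>R unhat (transpose (fst (fst z)) ** fst (snd z)))"

lemma body_of_chart: "rotation_matrix g \<Longrightarrow> body_of (chart g x w) = w"
  by (simp add: body_of_def chart_def rotation_cancel inertia_inverse d_pos)

lemma inertia_inj: "inertia d *v v = inertia d *v w \<longleftrightarrow> v = w"
  using inertia_inverse[OF d_pos] by metis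

lemma momentum_to_Omega_chart:
  assumes g: "rotation_matrix g"
  shows "momentum_to_Omega d m r A (chart g x w) = w"
proof -
  have "(THE v. v \<in> constraint_distribution r A (g, x) \<and>
       Legendre config_space (lagrangian d m) (g, x) v =
       (g ** hat ((1/2) *\<^sub>R (inertia d *v w)), (m * r) *\<^sub>R (A *v (g *v w)))) =
       (g ** hat w, r *\<^sub>R (A *v (g *v w)))"
  proof (rule the_equality)
    fix v assume v: "v \<in> constraint_distribution r A (g, x) \<and>
       Legendre config_space (lagrangian d m) (g, x) v =
       (g ** hat ((1/2) *\<^sub>R (inertia d *v w)), (m * r) *\<^sub>R (A *v (g *v w)))"
    then obtain w' where w': "v = (g ** hat w', r *\<^sub>R (A *v (g *v w')))"
      by (auto simp: constraint_distribution_config g)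
    with v have "chart g x w' = chart g x w"
      by (simp add: Legendre_config g chart_def)
    then have "w' = w" using body_of_chart[OF g] by metis
    then show "v = (g ** hat w, r *\<^sub>R (A *v (g *v w)))" by (simp add: w')
  qed (auto simp: constraint_distribution_config Legendre_config g)
  then show ?thesis
    by (simp add: momentum_to_Omega_def chart_def g)
qed

text \<open>Conjugating \<open>gram\<close> by g turns the axis \<open>e3\<close> into \<gamma>, so
  K depends on g through \<gamma> alone.\<close>

lemma orbit_projection_chart:
  assumes g: "rotation_matrix g"
  shows "orbit_projection d m r A (chart g x w) = (transpose g *v e3, Kmap (transpose g *v e3) w)"
proof -
  have "fst (fst (chart g x w)) = g" by (simp add: chart_def)
  then show ?thesis
    by (simp add: orbit_projection_def K_coord_def Let_def momentum_to_Omega_chart g matrix_inv_rotation gram K_eq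
       matrix_vector_right_distrib matrix_vector_mult_scaleR rotation_cancel transpose_inner)
qed

lemma norm_transpose_e3: "rotation_matrix g \<Longrightarrow> norm (transpose g *v e3 :: real^3) = 1"
  by (simp add: norm_eq_1 orthogonal_matrix_mult_inner rotation_matrixD rotation_matrix_transpose inner_axis_axis)

lemma orbit_projection_in_reduced_space:
  "z \<in> constraint_manifold d m r A \<Longrightarrow> orbit_projection d m r A z \<in> reduced_space"
  by (auto simp: constraint_manifold_eq orbit_projection_chart reduced_space_def norm_transpose_e3)

lemma orbit_projection_image:
  "orbit_projection d m r A ` constraint_manifold d m r A = reduced_space"
proof (intro equalityI subsetI)
  fix y :: "(real^3) \<times> (real^3)" assume "y \<in> reduced_space"
  then obtain \<gamma> K where y: "y = (\<gamma>, K)" and \<gamma>: "norm \<gamma> = 1"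
    by (auto simp: reduced_space_def)
  obtain h :: "real^3^3" where h: "rotation_matrix h" "h *v e3 = \<gamma>"
    using rotation_matrix_exists_basis[of \<gamma> 3] \<gamma> by auto
  \<comment> \<open>The attitude has to be \<open>transpose h\<close>, because \<gamma> is
    \<open>transpose g *v e3\<close>.\<close>
  have "orbit_projection d m r A (chart (transpose h) 0 (Omega_of d m r j \<gamma> K)) = y"
    using h y \<gamma> by (simp add: orbit_projection_chart rotation_matrix_transpose)
  then show "y \<in> orbit_projection d m r A ` constraint_manifold d m r A"
    using h by (metis chart_in_manifold image_eqI rotation_matrix_transpose)
qed (use orbit_projection_in_reduced_space in auto)

section \<open>Tangent vectors of the constraint manifold\<close>

text \<open>The push-forward under \<open>chart\<close> of g' = \<open>g ** hat \<xi>\<close>, x' =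
  u, w' = \<eta>; the terms with \<open>hat \<xi>\<close> on the left and
  \<open>cross3 \<xi> w\<close> come from differentiating the factor g.\<close>

definition tangent_chart :: "real^3^3 \<Rightarrow> real^3 \<Rightarrow> real^3 \<Rightarrow> real^3 \<Rightarrow> real^3 \<Rightarrow> config \<times> config" where
  "tangent_chart g w \<xi> u \<eta> =
     ((g ** hat \<xi>, u),
      (g ** (hat \<xi> ** hat ((1/2) *\<^sub>R (inertia d *v w)) + hat ((1/2) *\<^sub>R (inertia d *v \<eta>))),
       (m * r) *\<^sub>R (A *v (g *v (cross3 \<xi> w + \<eta>)))))"

lemma chart_has_derivative:
  assumes "G 0 = g" "(G has_vector_derivative g ** hat \<xi>) (at 0)" "(X has_vector_derivative u) (at 0)"
    "W 0 = w" "(W has_vector_derivative \<eta>) (at 0)"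
  shows "((\<lambda>t. chart (G t) (X t) (W t)) has_vector_derivative tangent_chart g w \<xi> u \<eta>) (at 0)"
proof -
  let ?h = "\<lambda>w. hat ((1/2) *\<^sub>R (inertia d *v w))"
  have "((\<lambda>t. ?h (W t)) has_vector_derivative ?h \<eta>) (at 0)"
    by (intro matrix_derivative_intros bounded_linear.has_vector_derivative[OF bounded_linear_scaleR_right] assms)
  from bounded_bilinear.has_vector_derivative[OF bounded_bilinear_matrix_mult assms(2) this]
  have P: "((\<lambda>t. G t ** ?h (W t)) has_vector_derivative g ** (hat \<xi> ** ?h w + ?h \<eta>)) (at 0)"
    using assms by (simp add: matrix_add_ldistrib matrix_mul_assoc add.commute)
  from bounded_bilinear.has_vector_derivative[OF bounded_bilinear_matrix_vector_mult assms(2) assms(5)]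
  have "((\<lambda>t. G t *v W t) has_vector_derivative g *v (cross3 \<xi> w + \<eta>)) (at 0)"
    using assms by (simp add: matrix_vector_right_distrib add.commute flip: matrix_vector_mul_assoc)
  then have u: "((\<lambda>t. (m * r) *\<^sub>R (A *v (G t *v W t))) has_vector_derivative
      (m * r) *\<^sub>R (A *v (g *v (cross3 \<xi> w + \<eta>)))) (at 0)"
    by (intro matrix_derivative_intros bounded_linear.has_vector_derivative[OF bounded_linear_scaleR_right])
  have "(G has_vector_derivative g ** hat \<xi>) (at 0)"
    using assms by simp
  then show ?thesis
    unfolding chart_def tangent_chart_def by (intro has_vector_derivative_Pair P u assms)
qed

text \<open>Projections and \<open>body_of\<close> recover the components of a curve, so they are
  differentiable whenever the curve is. Only existence of the derivative of W is taken from this;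
  uniqueness of derivatives then identifies v.\<close>

lemma manifold_curveE:
  assumes g: "rotation_matrix g" and c: "has_velocity (constraint_manifold d m r A) (chart g x w) v c"
  obtains G X W \<xi> u \<eta> where "\<And>t. rotation_matrix (G t)" "\<And>t. c t = chart (G t) (X t) (W t)"
    "G 0 = g" "W 0 = w" "(G has_vector_derivative g ** hat \<xi>) (at 0)"
    "(X has_vector_derivative u) (at 0)" "(W has_vector_derivative \<eta>) (at 0)"
    "v = tangent_chart g w \<xi> u \<eta>"
proof -
  define G where "G t = fst (fst (c t))" for t
  define X where "X t = snd (fst (c t))" for t
  define W where "W t = body_of (c t)" for t
  have c': "c 0 = chart g x w" "\<And>t. c t \<in> constraint_manifold d m r A" "(c has_vector_derivative v) (at 0)"
    using c by (auto simp: has_velocity_def)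
  have *: "rotation_matrix (G t) \<and> c t = chart (G t) (X t) (W t)" for t
  proof -
    obtain g' x' w' where "rotation_matrix g'" "c t = chart g' x' w'"
      using c'(2)[of t] by (auto simp: constraint_manifold_eq)
    moreover from this have "G t = g'" "X t = x'" "W t = w'"
      by (auto simp: G_def X_def W_def body_of_chart) (auto simp: chart_def)
    ultimately show ?thesis by simp
  qed
  have 0: "G 0 = g" "W 0 = w"
    using g by (auto simp: G_def W_def c' body_of_chart) (auto simp: chart_def)
  have dG: "(G has_vector_derivative fst (fst v)) (at 0)"
    unfolding G_def[abs_def] by (intro matrix_derivative_intros c')
  then obtain \<xi> where \<xi>: "fst (fst v) = g ** hat \<xi>"
    using rotation_curve_velocity[of G] * 0 by metis
  have dX: "(X has_vector_derivative snd (fst v)) (at 0)"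
    unfolding X_def[abs_def] by (intro matrix_derivative_intros c')
  have "((\<lambda>t. transpose (G t) ** fst (snd (c t))) has_vector_derivative
      transpose (G 0) ** fst (snd v) + transpose (fst (fst v)) ** fst (snd (c 0))) (at 0)"
    by (intro matrix_derivative_intros c' dG)
  then have "(W has_vector_derivative inertia (\<chi> i. inverse (d $ i)) *v (2 *\<^sub>R unhat
      (transpose (G 0) ** fst (snd v) + transpose (fst (fst v)) ** fst (snd (c 0))))) (at 0)"
    unfolding W_def[abs_def] body_of_def G_def[symmetric]
    by (rule bounded_linear.has_vector_derivative[OF matrix_vector_mul_bounded_linear
        bounded_linear.has_vector_derivative[OF bounded_linear_scaleR_right
          bounded_linear.has_vector_derivative[OF bounded_linear_unhat]]])
  then obtain \<eta> where \<eta>: "(W has_vector_derivative \<eta>) (at 0)" by blast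
  have "((\<lambda>t. chart (G t) (X t) (W t)) has_vector_derivative tangent_chart g w \<xi> (snd (fst v)) \<eta>) (at 0)"
    using chart_has_derivative[of G g \<xi> X _ W w, OF 0(1) _ dX 0(2) \<eta>] dG \<xi> by simp
  moreover have "(\<lambda>t. chart (G t) (X t) (W t)) = c"
    using * by auto
  ultimately have "v = tangent_chart g w \<xi> (snd (fst v)) \<eta>"
    using c'(3) vector_derivative_unique_at by metis
  with that[of G X W \<xi> "snd (fst v)" \<eta>] * 0 dG dX \<eta> \<xi> show ?thesis by metis
qed

lemma tangent_manifold:
  assumes g: "rotation_matrix g"
  shows "tangent_at (constraint_manifold d m r A) (chart g x w) = {tangent_chart g w \<xi> u \<eta> | \<xi> u \<eta>. True}"
proof (intro equalityI subsetI)
  fix v assume "v \<in> tangent_at (constraint_manifold d m r A) (chart g x w)"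
  then show "v \<in> {tangent_chart g w \<xi> u \<eta> | \<xi> u \<eta>. True}"
    unfolding tangent_at_def by (auto elim!: manifold_curveE[OF g])
next
  fix v assume "v \<in> {tangent_chart g w \<xi> u \<eta> | \<xi> u \<eta>. True}"
  then obtain \<xi> u \<eta> where v: "v = tangent_chart g w \<xi> u \<eta>" by blast
  obtain G where G: "\<And>t. rotation_matrix (G t)" "G 0 = g" "(G has_vector_derivative g ** hat \<xi>) (at 0)"
    using rotation_curve_exists[OF g] by metis
  have "has_velocity (constraint_manifold d m r A) (chart g x w) v
      (\<lambda>t. chart (G t) (x + t *\<^sub>R u) (w + t *\<^sub>R \<eta>))"
    unfolding has_velocity_def v
    by (intro conjI allI chart_has_derivative has_vector_derivative_line chart_in_manifold) (use G in simp_all)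
  then show "v \<in> tangent_at (constraint_manifold d m r A) (chart g x w)"
    by (auto simp: tangent_at_def)
qed

lemma nh_distribution_chart:
  assumes g: "rotation_matrix g"
  shows "nh_distribution d m r A (chart g x w) = {tangent_chart g w \<xi> (r *\<^sub>R (A *v (g *v \<xi>))) \<eta> | \<xi> \<eta>. True}"
proof -
  have "constraint_form r A (fst (chart g x w)) (fst (tangent_chart g w \<xi> u \<eta>)) = 0 \<longleftrightarrow> u = r *\<^sub>R (A *v (g *v \<xi>))" for \<xi> u \<eta>
    by (simp add: chart_def tangent_chart_def constraint_form_config g)
  then show ?thesis
    unfolding nh_distribution_def tangent_manifold[OF g] set_eq_iff mem_Collect_eq by metis
qed

text \<open>The derivative of \<open>K\<close> along a motion with body velocity \<open>\<xi>\<close> and \<open>\<Omega>' = \<eta>\<close>; the second summand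
  comes from \<open>\<gamma>' = \<gamma> \<times> \<xi>\<close>.\<close>

definition K_dot :: "real^3 \<Rightarrow> real^3 \<Rightarrow> real^3 \<Rightarrow> real^3 \<Rightarrow> real^3" where
  "K_dot \<gamma> w \<xi> \<eta> = Kmap \<gamma> \<eta> +
     (m * r\<^sup>2 * \<beta>) *\<^sub>R ((w \<bullet> cross3 \<gamma> \<xi>) *\<^sub>R \<gamma> + (w \<bullet> \<gamma>) *\<^sub>R cross3 \<gamma> \<xi>)"

lemma orbit_projection_has_derivative:
  assumes g: "rotation_matrix g" and c: "has_velocity (constraint_manifold d m r A) (chart g x w) (tangent_chart g w \<xi> u \<eta>) c"
  defines "\<gamma> \<equiv> transpose g *v e3"
  shows "((\<lambda>t. orbit_projection d m r A (c t)) has_vector_derivative (cross3 \<gamma> \<xi>, K_dot \<gamma> w \<xi> \<eta>)) (at 0)"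
proof -
  obtain G X W \<xi>' u' \<eta>' where c: "\<And>t. rotation_matrix (G t)" "\<And>t. c t = chart (G t) (X t) (W t)"
    "G 0 = g" "W 0 = w" "(G has_vector_derivative g ** hat \<xi>') (at 0)"
    "(X has_vector_derivative u') (at 0)" and W: "(W has_vector_derivative \<eta>') (at 0)"
    and eq: "tangent_chart g w \<xi> u \<eta> = tangent_chart g w \<xi>' u' \<eta>'"
    using manifold_curveE[OF g c] by metis
  \<comment> \<open>\<open>tangent_chart\<close> determines \<xi> and \<eta>: g cancels in the
    attitude component, then in the momentum component.\<close>
  have \<xi>: "\<xi>' = \<xi>" and \<eta>: "\<eta>' = \<eta>"
    using eq by (auto simp: tangent_chart_def rotation_left_cancel[OF g] inertia_inj)
  define \<Gamma> where "\<Gamma> t = transpose (G t) *v e3" for t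
  have d\<Gamma>: "(\<Gamma> has_vector_derivative cross3 \<gamma> \<xi>) (at 0)"
  proof -
    have "((\<lambda>t. transpose (G t) *v e3) has_vector_derivative
       transpose (G 0) *v 0 + transpose (g ** hat \<xi>) *v e3) (at 0)"
      using c(5) \<xi> by (intro matrix_derivative_intros has_vector_derivative_const) simp
    \<comment> \<open>Transposition reverses the sign of the hat matrix, whence the order \<gamma> x
      \<xi>.\<close>
    moreover have "transpose (g ** hat \<xi>) *v e3 = cross3 \<gamma> \<xi>"
      by (simp add: \<gamma>_def matrix_transpose_mul transpose_hat cross_skew[of _ \<xi>]
          bounded_bilinear.minus_left[OF bounded_bilinear_matrix_vector_mult] flip: matrix_vector_mul_assoc)
    ultimately show ?thesis by (simp add: \<Gamma>_def[abs_def])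
  qed
  have \<Gamma>0: "\<Gamma> 0 = \<gamma>" by (simp add: \<Gamma>_def \<gamma>_def c)
  have "((\<lambda>t. W t \<bullet> \<Gamma> t) has_vector_derivative w \<bullet> cross3 \<gamma> \<xi> + \<eta> \<bullet> \<gamma>) (at 0)"
    using bounded_bilinear.has_vector_derivative[OF bounded_bilinear_inner W d\<Gamma>] by (simp add: c \<Gamma>0 \<eta>)
  then have "((\<lambda>t. \<beta> * (W t \<bullet> \<Gamma> t)) has_real_derivative \<beta> * (w \<bullet> cross3 \<gamma> \<xi> + \<eta> \<bullet> \<gamma>)) (at 0)"
    unfolding has_real_derivative_iff_has_vector_derivative by (rule has_vector_derivative_mult_right)
  from has_vector_derivative_scaleR[OF this d\<Gamma>]
  have "((\<lambda>t. Kmap (\<Gamma> t) (W t)) has_vector_derivative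
     inertia d *v \<eta> + (m * r\<^sup>2) *\<^sub>R (\<alpha> *\<^sub>R \<eta> +
       ((\<beta> * (w \<bullet> \<gamma>)) *\<^sub>R cross3 \<gamma> \<xi> + (\<beta> * (w \<bullet> cross3 \<gamma> \<xi> + \<eta> \<bullet> \<gamma>)) *\<^sub>R \<gamma>))) (at 0)"
    unfolding K_eq using W
    by (intro has_vector_derivative_add matrix_derivative_intros
         bounded_linear.has_vector_derivative[OF bounded_linear_scaleR_right]) (simp_all add: c \<Gamma>0 \<eta>)
  also have "inertia d *v \<eta> + (m * r\<^sup>2) *\<^sub>R (\<alpha> *\<^sub>R \<eta> +
       ((\<beta> * (w \<bullet> \<gamma>)) *\<^sub>R cross3 \<gamma> \<xi> + (\<beta> * (w \<bullet> cross3 \<gamma> \<xi> + \<eta> \<bullet> \<gamma>)) *\<^sub>R \<gamma>)) = K_dot \<gamma> w \<xi> \<eta>"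
    by (simp add: K_dot_def K_eq algebra_simps)
  finally have "((\<lambda>t. (\<Gamma> t, Kmap (\<Gamma> t) (W t))) has_vector_derivative (cross3 \<gamma> \<xi>, K_dot \<gamma> w \<xi> \<eta>)) (at 0)"
    by (intro has_vector_derivative_Pair d\<Gamma>)
  then show ?thesis
    by (simp add: c orbit_projection_chart \<Gamma>_def)
qed

text \<open>The curve is projected first and differentiated in the reduced space, where f has the
  extension F; this avoids extending the composite off the constraint manifold.\<close>

lemma differential_reduced:
  assumes g: "rotation_matrix g"
  defines "\<gamma> \<equiv> transpose g *v e3"
  assumes F: "smooth_on_open U F" "(\<gamma>, Kmap \<gamma> w) \<in> U" "\<And>y. y \<in> U \<inter> reduced_space \<Longrightarrow> F y = f y"
  shows "differential (constraint_manifold d m r A) (f \<circ> orbit_projection d m r A) (chart g x w) (tangent_chart g w \<xi> u \<eta>)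
    = grad_gamma F (\<gamma>, Kmap \<gamma> w) \<bullet> cross3 \<gamma> \<xi> + grad_K F (\<gamma>, Kmap \<gamma> w) \<bullet> K_dot \<gamma> w \<xi> \<eta>"
proof (rule differential_eqI)
  show "tangent_chart g w \<xi> u \<eta> \<in> tangent_at (constraint_manifold d m r A) (chart g x w)"
    by (auto simp: tangent_manifold g)
next
  fix c assume c: "has_velocity (constraint_manifold d m r A) (chart g x w) (tangent_chart g w \<xi> u \<eta>) c"
  have c0: "orbit_projection d m r A (c 0) = (\<gamma>, Kmap \<gamma> w)"
    using c g by (simp add: has_velocity_def orbit_projection_chart \<gamma>_def)
  have "((\<lambda>t. f (orbit_projection d m r A (c t))) has_real_derivative
     frechet_derivative F (at (orbit_projection d m r A (c 0))) (cross3 \<gamma> \<xi>, K_dot \<gamma> w \<xi> \<eta>)) (at 0)"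
  proof (rule smooth_extension_chain[OF F(1) _ F(3)])
    show "orbit_projection d m r A (c 0) \<in> U" using F(2) c0 by simp
    show "orbit_projection d m r A (c t) \<in> reduced_space" for t
      using c by (simp add: has_velocity_def orbit_projection_in_reduced_space)
  qed (use orbit_projection_has_derivative[OF g c] in \<open>auto simp: \<gamma>_def\<close>)
  then show "((\<lambda>t. (f \<circ> orbit_projection d m r A) (c t)) has_real_derivative
     grad_gamma F (\<gamma>, Kmap \<gamma> w) \<bullet> cross3 \<gamma> \<xi> + grad_K F (\<gamma>, Kmap \<gamma> w) \<bullet> K_dot \<gamma> w \<xi> \<eta>) (at 0)"
    by (simp add: c0 frechet_derivative_gradients smooth_on_open_differentiable[OF F(1,2)])
qed

section \<open>The nonholonomic bracket of reduced functions\<close>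

lemma gram_inner:
  assumes g: "rotation_matrix g"
  defines "\<gamma> \<equiv> transpose g *v e3"
  shows "(A *v (g *v v)) \<bullet> (A *v (g *v w)) = \<alpha> * (v \<bullet> w) + \<beta> * (v \<bullet> \<gamma>) * (w \<bullet> \<gamma>)"
proof -
  have "(A *v (g *v v)) \<bullet> (A *v (g *v w)) = (g *v v) \<bullet> (transpose A *v (A *v (g *v w)))"
    by (rule transpose_inner)
  also have "\<dots> = \<alpha> * ((g *v v) \<bullet> (g *v w)) + \<beta> * ((g *v v) \<bullet> e3) * ((g *v w) \<bullet> e3)"
    by (simp add: gram inner_add_right)
  finally show ?thesis
    unfolding orthogonal_matrix_mult_inner[OF rotation_matrixD(1)[OF g]] by (simp add: transpose_inner \<gamma>_def)
qed

abbreviation "N \<equiv> N_vec d m r j"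

lemma canonical_two_form_tangent_chart:
  assumes g: "rotation_matrix g"
  defines "\<gamma> \<equiv> transpose g *v e3"
  shows "canonical_two_form z (tangent_chart g w \<xi> (r *\<^sub>R (A *v (g *v \<xi>))) \<eta>)
      (tangent_chart g w \<xi>' (r *\<^sub>R (A *v (g *v \<xi>'))) \<eta>') =
    \<xi> \<bullet> K_dot \<gamma> w \<xi>' \<eta>' - \<xi>' \<bullet> K_dot \<gamma> w \<xi> \<eta> + cross3 \<xi> \<xi>' \<bullet> N \<gamma> (Kmap \<gamma> w)"
proof -
  have \<gamma>: "norm \<gamma> = 1"
    by (simp add: \<gamma>_def norm_transpose_e3 g)
  let ?P = "(1/2) *\<^sub>R (inertia d *v w)"
  have *: "(g ** X) \<bullet> (g ** Y) = X \<bullet> Y" for X Y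
    by (simp add: orthogonal_matrix_mult_inner_matrix rotation_matrixD g)
  have "canonical_two_form z (tangent_chart g w \<xi> (r *\<^sub>R (A *v (g *v \<xi>))) \<eta>)
      (tangent_chart g w \<xi>' (r *\<^sub>R (A *v (g *v \<xi>'))) \<eta>') =
    (hat \<xi> \<bullet> (hat \<xi>' ** hat ?P) - hat \<xi>' \<bullet> (hat \<xi> ** hat ?P))
    + hat \<xi> \<bullet> hat ((1/2) *\<^sub>R (inertia d *v \<eta>')) - hat \<xi>' \<bullet> hat ((1/2) *\<^sub>R (inertia d *v \<eta>))
    + m * r\<^sup>2 * ((A *v (g *v \<xi>)) \<bullet> (A *v (g *v (cross3 \<xi>' w + \<eta>'))) - (A *v (g *v \<xi>')) \<bullet> (A *v (g *v (cross3 \<xi> w + \<eta>))))"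
    by (simp add: canonical_two_form_eq tangent_chart_def * inner_add_right power2_eq_square algebra_simps
        del: matrix_vector_right_distrib)
  also have "\<dots> = cross3 \<xi> \<xi>' \<bullet> (inertia d *v w) + \<xi> \<bullet> (inertia d *v \<eta>') - \<xi>' \<bullet> (inertia d *v \<eta>)
    + m * r\<^sup>2 * (\<alpha> * (\<xi> \<bullet> (cross3 \<xi>' w + \<eta>')) + \<beta> * (\<xi> \<bullet> \<gamma>) * ((cross3 \<xi>' w + \<eta>') \<bullet> \<gamma>)
      - (\<alpha> * (\<xi>' \<bullet> (cross3 \<xi> w + \<eta>)) + \<beta> * (\<xi>' \<bullet> \<gamma>) * ((cross3 \<xi> w + \<eta>) \<bullet> \<gamma>)))"
    unfolding inner_hat_commutator gram_inner[OF g] inner_hat by (simp add: \<gamma>_def)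
  also have "\<dots> = \<xi> \<bullet> K_dot \<gamma> w \<xi>' \<eta>' - \<xi>' \<bullet> K_dot \<gamma> w \<xi> \<eta> + cross3 \<xi> \<xi>' \<bullet> N \<gamma> (Kmap \<gamma> w)"
  proof -
    \<comment> \<open>With these identities N supplies two copies of the term in (w . \<gamma>)
      \<gamma>, which cancel against the \<open>cross3 \<gamma> \<xi>\<close> summands of the two
      \<open>K_dot\<close> terms. The other \<beta>-terms agree on both sides.\<close>
    have t: "\<xi> \<bullet> cross3 \<xi>' w = cross3 \<xi> \<xi>' \<bullet> w" "\<xi>' \<bullet> cross3 \<xi> w = - (cross3 \<xi> \<xi>' \<bullet> w)"
      "cross3 \<xi>' w \<bullet> \<gamma> = w \<bullet> cross3 \<gamma> \<xi>'" "cross3 \<xi> w \<bullet> \<gamma> = w \<bullet> cross3 \<gamma> \<xi>"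
      "\<xi> \<bullet> cross3 \<gamma> \<xi>' = - (cross3 \<xi> \<xi>' \<bullet> \<gamma>)" "\<xi>' \<bullet> cross3 \<gamma> \<xi> = cross3 \<xi> \<xi>' \<bullet> \<gamma>"
      by (simp_all add: cross3_simps)
    show ?thesis
      unfolding K_dot_def N_eq Omega_of_Kmap[OF \<gamma>]
      unfolding K_eq inner_add_left inner_add_right inner_scaleR_left inner_scaleR_right t
      by (simp add: algebra_simps)
  qed
  finally show ?thesis .
qed

text \<open>\<open>K_dot\<close> is affine in \<eta> with bijective linear part
  \<open>Kmap \<gamma>\<close>. Hence \<kappa> can replace \<eta> as a free coordinate on the
  distribution for every \<xi>.\<close>

lemma K_dot_surj:
  assumes "norm \<gamma> = 1" obtains \<eta> where "K_dot \<gamma> w \<xi> \<eta> = \<kappa>"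
proof
  show "K_dot \<gamma> w \<xi> (Omega_of d m r j \<gamma> (\<kappa> - (m * r\<^sup>2 * \<beta>) *\<^sub>R ((w \<bullet> cross3 \<gamma> \<xi>) *\<^sub>R \<gamma> + (w \<bullet> \<gamma>) *\<^sub>R cross3 \<gamma> \<xi>))) = \<kappa>"
    unfolding K_dot_def by (simp add: assms)
qed

lemma K_dot_inj:
  assumes "norm \<gamma> = 1" "K_dot \<gamma> w \<xi> \<eta> = K_dot \<gamma> w \<xi> \<eta>'" shows "\<eta> = \<eta>'"
  using assms bij_Kmap[OF assms(1)] by (auto simp: K_dot_def bij_def inj_def)

lemma nh_vector_field_reduced:
  fixes w :: "real^3"
  assumes g: "rotation_matrix g"
  defines "\<gamma> \<equiv> transpose g *v e3"
  defines "y \<equiv> (\<gamma>, Kmap \<gamma> w)"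
  assumes F: "smooth_on_open U F" "y \<in> U" "\<And>y. y \<in> U \<inter> reduced_space \<Longrightarrow> F y = f y"
  obtains \<eta> where "K_dot \<gamma> w (grad_K F y) \<eta> = cross3 (N \<gamma> (Kmap \<gamma> w)) (grad_K F y) + cross3 \<gamma> (grad_gamma F y)"
    "nh_vector_field d m r A (f \<circ> orbit_projection d m r A) (chart g x w) =
       tangent_chart g w (grad_K F y) (r *\<^sub>R (A *v (g *v grad_K F y))) \<eta>"
proof -
  have \<gamma>: "norm \<gamma> = 1"
    by (simp add: \<gamma>_def norm_transpose_e3 g)
  let ?V = "\<lambda>\<xi> \<eta>. tangent_chart g w \<xi> (r *\<^sub>R (A *v (g *v \<xi>))) \<eta>"
  let ?\<kappa> = "\<lambda>\<xi>. cross3 (N \<gamma> (Kmap \<gamma> w)) \<xi> + cross3 \<gamma> (grad_gamma F y)"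
  let ?D = "differential (constraint_manifold d m r A) (f \<circ> orbit_projection d m r A) (chart g x w)"
  let ?z = "chart g x w"
  have D: "?D (?V \<xi>' \<eta>') = \<xi>' \<bullet> cross3 (grad_gamma F y) \<gamma> + grad_K F y \<bullet> K_dot \<gamma> w \<xi>' \<eta>'" for \<xi>' \<eta>'
    unfolding y_def \<gamma>_def
    by (subst differential_reduced[OF g F(1) _ F(3)])
       (use F(2) in \<open>auto simp: y_def \<gamma>_def cross3_simps\<close>)
  have form: "canonical_two_form ?z (?V \<xi> \<eta>) (?V \<xi>' \<eta>') =
      \<xi> \<bullet> K_dot \<gamma> w \<xi>' \<eta>' - \<xi>' \<bullet> (K_dot \<gamma> w \<xi> \<eta> - cross3 (N \<gamma> (Kmap \<gamma> w)) \<xi>)" for \<xi> \<eta> \<xi>' \<eta>'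
  proof -
    have "cross3 \<xi> \<xi>' \<bullet> n = \<xi>' \<bullet> cross3 n \<xi>" for n
      by (simp add: cross3_simps)
    then show ?thesis
      unfolding \<gamma>_def canonical_two_form_tangent_chart[OF g] by (simp add: inner_diff_right)
  qed
  obtain \<eta> where \<eta>: "K_dot \<gamma> w (grad_K F y) \<eta> = ?\<kappa> (grad_K F y)"
    using K_dot_surj[OF \<gamma>] by blast
  have "nh_vector_field d m r A (f \<circ> orbit_projection d m r A) ?z = ?V (grad_K F y) \<eta>"
    unfolding nh_vector_field_def
  proof (rule the_equality)
    have "canonical_two_form ?z (?V (grad_K F y) \<eta>) (?V \<xi>' \<eta>') = ?D (?V \<xi>' \<eta>')" for \<xi>' \<eta>'
      unfolding form D \<eta> by (simp add: cross_skew[of \<gamma>])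
    then show "?V (grad_K F y) \<eta> \<in> nh_distribution d m r A ?z \<and>
      (\<forall>v\<in>nh_distribution d m r A ?z. canonical_two_form ?z (?V (grad_K F y) \<eta>) v = ?D v)"
      unfolding nh_distribution_chart[OF g] by blast
  next
    fix v assume v: "v \<in> nh_distribution d m r A ?z \<and>
      (\<forall>v'\<in>nh_distribution d m r A ?z. canonical_two_form ?z v v' = ?D v')"
    then obtain \<xi> \<eta>1 where v1: "v = ?V \<xi> \<eta>1"
      unfolding nh_distribution_chart[OF g] by blast
    have eq: "canonical_two_form ?z (?V \<xi> \<eta>1) (?V \<xi>' \<eta>') = ?D (?V \<xi>' \<eta>')" for \<xi>' \<eta>'
      using v unfolding nh_distribution_chart[OF g] v1 by blast
    \<comment> \<open>Both sides of \<open>eq\<close> are linear in the pair (\<xi>', \<kappa>),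
      which is arbitrary by \<open>K_dot_surj\<close>; here the coefficients are collected.\<close>
    have eq': "(\<xi> - grad_K F y) \<bullet> \<kappa> = \<xi>' \<bullet> (K_dot \<gamma> w \<xi> \<eta>1 - ?\<kappa> \<xi>)" for \<xi>' \<kappa>
    proof -
      obtain \<eta>' where "K_dot \<gamma> w \<xi>' \<eta>' = \<kappa>" using K_dot_surj[OF \<gamma>] by blast
      with eq[of \<xi>' \<eta>'] show ?thesis
        unfolding form D
        by (simp add: inner_diff_left inner_diff_right inner_add_right cross_skew[of \<gamma>])
    qed
    \<comment> \<open>The instantiation takes \<kappa> first and \<xi>' second. Setting one of them
      to 0 and the other to the vector in question makes its squared norm vanish, here and in the
      next step.\<close>
    have \<xi>: "\<xi> = grad_K F y"
      using eq'[of "\<xi> - grad_K F y" 0] by simp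
    have "K_dot \<gamma> w \<xi> \<eta>1 = ?\<kappa> \<xi>"
      using eq'[of 0 "K_dot \<gamma> w \<xi> \<eta>1 - ?\<kappa> \<xi>"] by simp
    then have "K_dot \<gamma> w \<xi> \<eta>1 = K_dot \<gamma> w \<xi> \<eta>"
      by (simp add: \<eta> \<xi>)
    then have "\<eta>1 = \<eta>"
      by (rule K_dot_inj[OF \<gamma>])
    then show "v = ?V (grad_K F y) \<eta>"
      by (simp add: v1 \<xi>)
  qed
  with \<eta> that show ?thesis by blast
qed

text \<open>The extensions are absent from the left side, and the right side sees z only through y.
  So one equation gives both independence of the extensions and constancy on fibres.\<close>

lemma nh_bracket_reduced:
  assumes z: "z \<in> constraint_manifold d m r A" and y: "orbit_projection d m r A z = y"
    and F1: "smooth_on_open U1 F1" "y \<in> U1" "\<And>y. y \<in> U1 \<inter> reduced_space \<Longrightarrow> F1 y = f1 y"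
    and F2: "smooth_on_open U2 F2" "y \<in> U2" "\<And>y. y \<in> U2 \<inter> reduced_space \<Longrightarrow> F2 y = f2 y"
  shows "nh_bracket d m r A (f1 \<circ> orbit_projection d m r A) (f2 \<circ> orbit_projection d m r A) z =
    rank_bracket d m r j F1 F2 y"
proof -
  obtain g x w where g: "rotation_matrix g" and zc: "z = chart g x w"
    using z by (auto simp: constraint_manifold_eq)
  define \<gamma> where "\<gamma> = transpose g *v e3"
  have yc: "y = (\<gamma>, Kmap \<gamma> w)"
    using y by (simp add: zc orbit_projection_chart g \<gamma>_def)
  let ?K1 = "grad_K F1 y" and ?K2 = "grad_K F2 y" and ?n = "N \<gamma> (Kmap \<gamma> w)"
  obtain \<eta>1 where 1: "K_dot \<gamma> w ?K1 \<eta>1 = cross3 ?n ?K1 + cross3 \<gamma> (grad_gamma F1 y)"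
    "nh_vector_field d m r A (f1 \<circ> orbit_projection d m r A) z = tangent_chart g w ?K1 (r *\<^sub>R (A *v (g *v ?K1))) \<eta>1"
    using nh_vector_field_reduced[OF g F1(1) _ F1(3), of w x] F1(2) by (auto simp: yc \<gamma>_def zc)
  obtain \<eta>2 where 2: "K_dot \<gamma> w ?K2 \<eta>2 = cross3 ?n ?K2 + cross3 \<gamma> (grad_gamma F2 y)"
    "nh_vector_field d m r A (f2 \<circ> orbit_projection d m r A) z = tangent_chart g w ?K2 (r *\<^sub>R (A *v (g *v ?K2))) \<eta>2"
    using nh_vector_field_reduced[OF g F2(1) _ F2(3), of w x] F2(2) by (auto simp: yc \<gamma>_def zc)
  have "nh_bracket d m r A (f1 \<circ> orbit_projection d m r A) (f2 \<circ> orbit_projection d m r A) z =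
     ?K1 \<bullet> (cross3 ?n ?K2 + cross3 \<gamma> (grad_gamma F2 y)) - ?K2 \<bullet> (cross3 ?n ?K1 + cross3 \<gamma> (grad_gamma F1 y))
     + cross3 ?K1 ?K2 \<bullet> ?n"
    unfolding nh_bracket_def 1(2) 2(2) canonical_two_form_tangent_chart[OF g] \<gamma>_def[symmetric] 1(1) 2(1) ..
  also have "\<dots> = rank_bracket d m r j F1 F2 y"
  proof -
    \<comment> \<open>The two \<kappa>-terms each contribute -n . (a x b) and the N-term of the form
      contributes +n . (a x b), which leaves a single negative copy.\<close>
    have "a \<bullet> (cross3 n b + cross3 c p) - b \<bullet> (cross3 n a + cross3 c q) + cross3 a b \<bullet> n =
       - (n \<bullet> cross3 a b) - c \<bullet> (cross3 a p - cross3 b q)" for a b c n p q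
      by (simp add: cross3_simps)
    then show ?thesis
      by (simp add: rank_bracket_def yc)
  qed
  finally show ?thesis .
qed

section \<open>Orbits and the reduced bracket\<close>

text \<open>Left multiplication by h is an isometry of the ambient inner product, so the lift acts
  on momenta by h as well; \<open>commute\<close> moves h past A, which keeps the image in the
  constraint manifold with the same \<Omega>.\<close>

lemma cotangent_lift_chart:
  assumes g: "rotation_matrix g" and h: "rotation_matrix h" "h *v e3 = e3"
  shows "cotangent_lift config_space (action (h, y)) (chart g x w) = chart (h ** g) (h *v x + y) w"
proof -
  have D: "frechet_derivative (action (h, y)) (at q) = (\<lambda>v. (h ** fst v, h *v snd v))" for q
    unfolding action_def fst_conv snd_conv
    by (intro frechet_derivative_at[symmetric] has_derivative_Pair has_derivative_add_const
        bounded_linear.has_derivative[OF bounded_bilinear.bounded_linear_right[OF bounded_bilinear_matrix_mult]]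
        bounded_linear.has_derivative[OF matrix_vector_mul_bounded_linear]
        has_derivative_fst has_derivative_snd has_derivative_ident)
  have hg: "rotation_matrix (h ** g)"
    by (intro rotation_matrix_mult g h)
  define P where "P = g ** hat ((1/2) *\<^sub>R (inertia d *v w))"
  define u where "u = (m * r) *\<^sub>R (A *v (g *v w))"
  have h_inner: "(h ** X) \<bullet> (h ** Y) = X \<bullet> Y" "(h *v a) \<bullet> (h *v b) = a \<bullet> b" for X Y a b
    by (simp_all add: orthogonal_matrix_mult_inner_matrix orthogonal_matrix_mult_inner rotation_matrixD h)
  have "(THE p'. p' \<in> tangent_at config_space (h ** g, h *v x + y) \<and>
      (\<forall>v\<in>tangent_at config_space (g, x). p' \<bullet> (h ** fst v, h *v snd v) = (P, u) \<bullet> v)) = (h ** P, h *v u)"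
  proof (rule the_equality)
    show p: "(h ** P, h *v u) \<in> tangent_at config_space (h ** g, h *v x + y) \<and>
      (\<forall>v\<in>tangent_at config_space (g, x). (h ** P, h *v u) \<bullet> (h ** fst v, h *v snd v) = (P, u) \<bullet> v)"
      by (auto simp: tangent_config_space hg P_def matrix_mul_assoc[symmetric] h_inner inner_prod_def)
    fix p' assume p': "p' \<in> tangent_at config_space (h ** g, h *v x + y) \<and>
      (\<forall>v\<in>tangent_at config_space (g, x). p' \<bullet> (h ** fst v, h *v snd v) = (P, u) \<bullet> v)"
    show "p' = (h ** P, h *v u)"
    proof (rule tangent_config_eqI[OF hg])
      fix v assume "v \<in> tangent_at config_space (h ** g, h *v x + y)"
      then obtain \<omega> b where v: "v = ((h ** g) ** hat \<omega>, b)"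
        by (auto simp: tangent_config_space hg)
      let ?v = "(g ** hat \<omega>, transpose h *v b)"
      have v': "v = (h ** fst ?v, h *v snd ?v)"
        by (simp add: v rotation_cancel h matrix_mul_assoc)
      have "?v \<in> tangent_at config_space (g, x)"
        by (auto simp: tangent_config_space g)
      then have "(h ** P, h *v u) \<bullet> (h ** fst ?v, h *v snd ?v) = (P, u) \<bullet> ?v"
        "p' \<bullet> (h ** fst ?v, h *v snd ?v) = (P, u) \<bullet> ?v"
        using p p' by blast+
      then show "p' \<bullet> v = (h ** P, h *v u) \<bullet> v"
        by (simp only: v')
    qed (use p p' in auto)
  qed
  then show ?thesis
    by (simp add: cotangent_lift_def chart_def D P_def u_def)
       (simp add: action_def matrix_mul_assoc matrix_vector_mult_scaleR commute h flip: matrix_vector_mul_assoc)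
qed

lemma orbit_projection_fibre:
  assumes z: "z \<in> constraint_manifold d m r A"
  shows "{z' \<in> constraint_manifold d m r A. orbit_projection d m r A z' = orbit_projection d m r A z} =
    {cotangent_lift config_space (action k) z | k. k \<in> sym_group}"
proof -
  obtain g x w where g: "rotation_matrix g" and zc: "z = chart g x w"
    using z by (auto simp: constraint_manifold_eq)
  show ?thesis
  proof (intro equalityI subsetI)
    fix z' assume "z' \<in> {z' \<in> constraint_manifold d m r A. orbit_projection d m r A z' = orbit_projection d m r A z}"
    then obtain g' x' w' where g': "rotation_matrix g'" and zc': "z' = chart g' x' w'"
      and eq: "orbit_projection d m r A (chart g' x' w') = orbit_projection d m r A (chart g x w)"
      by (auto simp: constraint_manifold_eq zc)
    have \<gamma>: "transpose g' *v e3 = transpose g *v e3" and "Kmap (transpose g *v e3) w' = Kmap (transpose g *v e3) w"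
      using eq by (auto simp: orbit_projection_chart g g')
    then have w: "w' = w"
      using Omega_of_Kmap[OF norm_transpose_e3[OF g]] by metis
    \<comment> \<open>The only rotation carrying g to g'; it fixes \<open>e3\<close> because both
      attitudes have the same \<gamma>.\<close>
    define h where "h = g' ** transpose g"
    have h: "rotation_matrix h"
      unfolding h_def by (intro rotation_matrix_mult rotation_matrix_transpose g g')
    have he: "h *v e3 = e3"
      unfolding h_def matrix_vector_mul_assoc[symmetric] \<gamma>[symmetric] by (simp add: rotation_cancel g')
    have "h ** g = g'"
      by (simp add: h_def rotation_matrixD g flip: matrix_mul_assoc)
    then have "z' = cotangent_lift config_space (action (h, x' - h *v x)) z"
      by (simp add: zc zc' cotangent_lift_chart g h he w)
    moreover have "(h, x' - h *v x) \<in> sym_group"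
      by (simp add: sym_group_def h he)
    ultimately show "z' \<in> {cotangent_lift config_space (action k) z | k. k \<in> sym_group}"
      by blast
  next
    fix z' assume "z' \<in> {cotangent_lift config_space (action k) z | k. k \<in> sym_group}"
    then obtain h y where h: "rotation_matrix h" "h *v e3 = e3" and "z' = chart (h ** g) (h *v x + y) w"
      by (auto simp: sym_group_def zc cotangent_lift_chart g)
    moreover have "rotation_matrix (h ** g)"
      by (intro rotation_matrix_mult g h)
    moreover have "transpose (h ** g) *v e3 = transpose g *v e3"
      by (simp add: matrix_transpose_mul transpose_fixes_e3 h flip: matrix_vector_mul_assoc)
    ultimately show "z' \<in> {z' \<in> constraint_manifold d m r A. orbit_projection d m r A z' = orbit_projection d m r A z}"
      by (simp add: zc g orbit_projection_chart)
  qed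
qed

section \<open>Existence and uniqueness of the reduced bracket\<close>

lemma smooth_functionsE:
  assumes "f \<in> smooth_functions S" "x \<in> S"
  obtains U F where "smooth_on_open U F" "x \<in> U" "\<forall>y\<in>U \<inter> S. F y = f y"
  using assms unfolding smooth_functions_def by blast

text \<open>The bracket is evaluated at a chosen point of each fibre. The choice is immaterial,
  since \<open>nh_bracket_reduced\<close> equates the values at any two points with the same
  \<open>rank_bracket\<close>.\<close>

lemma reduced_bracket_exists: "\<exists>red. is_reduced_bracket d m r A red"
proof
  let ?M = "constraint_manifold d m r A" and ?\<rho> = "orbit_projection d m r A"
  show "is_reduced_bracket d m r A (\<lambda>f1 f2 y. nh_bracket d m r A (f1 \<circ> ?\<rho>) (f2 \<circ> ?\<rho>) (SOME z. z \<in> ?M \<and> ?\<rho> z = y))"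
    unfolding is_reduced_bracket_def
  proof (intro ballI)
    fix f1 f2 z assume f: "f1 \<in> smooth_functions reduced_space" "f2 \<in> smooth_functions reduced_space" and z: "z \<in> ?M"
    define z' where "z' = (SOME z'. z' \<in> ?M \<and> ?\<rho> z' = ?\<rho> z)"
    have "z' \<in> ?M \<and> ?\<rho> z' = ?\<rho> z"
      unfolding z'_def by (rule someI[of _ z]) (simp add: z)
    then have z': "z' \<in> ?M" "?\<rho> z' = ?\<rho> z" by auto
    have y: "?\<rho> z \<in> reduced_space"
      using z by (rule orbit_projection_in_reduced_space)
    obtain U1 F1 where 1: "smooth_on_open U1 F1" "?\<rho> z \<in> U1" "\<forall>y\<in>U1 \<inter> reduced_space. F1 y = f1 y"
      by (rule smooth_functionsE[OF f(1) y])
    obtain U2 F2 where 2: "smooth_on_open U2 F2" "?\<rho> z \<in> U2" "\<forall>y\<in>U2 \<inter> reduced_space. F2 y = f2 y"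
      by (rule smooth_functionsE[OF f(2) y])
    show "nh_bracket d m r A (f1 \<circ> ?\<rho>) (f2 \<circ> ?\<rho>) (SOME z'. z' \<in> ?M \<and> ?\<rho> z' = ?\<rho> z) =
      nh_bracket d m r A (f1 \<circ> ?\<rho>) (f2 \<circ> ?\<rho>) z"
      unfolding z'_def[symmetric]
      by (rule trans[OF nh_bracket_reduced[OF z' 1(1,2) _ 2(1,2)] nh_bracket_reduced[OF z refl 1(1,2) _ 2(1,2), symmetric]])
         (use 1(3) 2(3) in blast)+
  qed
qed

lemma reduced_bracket_eq:
  assumes red: "is_reduced_bracket d m r A red"
    and f: "f1 \<in> smooth_functions reduced_space" "f2 \<in> smooth_functions reduced_space"
    and F: "smooth_on_open U F1" "smooth_on_open U F2" "\<And>y. y \<in> U \<inter> reduced_space \<Longrightarrow> F1 y = f1 y \<and> F2 y = f2 y"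
    and y: "y \<in> U \<inter> reduced_space"
  shows "red f1 f2 y = rank_bracket d m r j F1 F2 y"
proof -
  have "y \<in> orbit_projection d m r A ` constraint_manifold d m r A"
    using y by (simp add: orbit_projection_image)
  then obtain z where z: "z \<in> constraint_manifold d m r A" "orbit_projection d m r A z = y"
    by auto
  have "red f1 f2 y = nh_bracket d m r A (f1 \<circ> orbit_projection d m r A) (f2 \<circ> orbit_projection d m r A) z"
    using red f z(1) unfolding is_reduced_bracket_def z(2)[symmetric] by blast
  also have "\<dots> = rank_bracket d m r j F1 F2 y"
    using F y by (intro nh_bracket_reduced[OF z F(1) _ _ F(2)]) auto
  finally show ?thesis .
qed

end

text \<open>The K-gradient is 0 and the \<gamma>-gradient is 2 \<gamma>, so what survives is a
  triple product containing \<gamma> twice.\<close>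

lemma rank_bracket_norm_gamma: "rank_bracket d m r j (\<lambda>y. (norm (fst y))\<^sup>2) F y = 0"
proof -
  have "((\<lambda>y::(real^3) \<times> (real^3). (norm (fst y))\<^sup>2) has_derivative (\<lambda>v. 2 * (fst y \<bullet> fst v))) (at y)"
    unfolding power2_norm_eq_inner by (auto intro!: derivative_eq_intros simp: inner_commute)
  then have D: "frechet_derivative (\<lambda>y::(real^3) \<times> (real^3). (norm (fst y))\<^sup>2) (at y) = (\<lambda>v. 2 * (fst y \<bullet> fst v))"
    by (rule frechet_derivative_at[symmetric])
  have "grad_K (\<lambda>y. (norm (fst y))\<^sup>2) y = 0"
    by (simp add: grad_K_def D vec_eq_iff)
  moreover have "grad_gamma (\<lambda>y. (norm (fst y))\<^sup>2) y = 2 *\<^sub>R fst y"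
    by (simp add: grad_gamma_def D vec_eq_iff inner_axis)
  ultimately show ?thesis
    by (simp add: rank_bracket_def cross_mult_right dot_cross_self)
qed

section \<open>The four types of constraint matrices\<close>

text \<open>The squares of d - a and c + b add up to the sum of all squared entries minus twice the
  determinant, that is 2 - 2.\<close>

lemma SO2_entries:
  fixes a b c d :: real
  assumes "a * a + c * c = 1" "b * b + d * d = 1" "a * d - b * c = 1"
  shows "d = a" "c = - b"
proof -
  have "(d - a)\<^sup>2 + (c + b)\<^sup>2 = 0"
    using assms by (simp add: power2_eq_square algebra_simps)
  then have "d - a = 0 \<and> c + b = 0"
    by (simp add: sum_power2_eq_zero_iff)
  then show "d = a" "c = - b" by auto
qed

lemma block_matrix_rotation:
  assumes "rotation_matrix C"
  obtains a b where "a * a + b * b = 1"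
    "\<And>\<delta> v. block_matrix C \<delta> *v v = vector [a * v$1 - b * v$2, b * v$1 + a * v$2, \<delta> * v$3]"
    "\<And>\<delta> v. transpose (block_matrix C \<delta>) *v v = vector [a * v$1 + b * v$2, - b * v$1 + a * v$2, \<delta> * v$3]"
proof -
  have "(transpose C ** C) $ 1 $ 1 = 1" "(transpose C ** C) $ 2 $ 2 = 1" "det C = 1"
    using rotation_matrixD[OF assms] by (simp_all add: mat_def)
  then have 1: "C$1$1 * C$1$1 + C$2$1 * C$2$1 = 1" "C$1$2 * C$1$2 + C$2$2 * C$2$2 = 1" "C$1$1 * C$2$2 - C$1$2 * C$2$1 = 1"
    by (simp_all add: matrix_matrix_mult_def transpose_def sum_2 det_2)
  note 2 = SO2_entries[OF 1]
  show ?thesis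
  proof
    show "C$1$1 * C$1$1 + C$2$1 * C$2$1 = 1" by (rule 1)
  qed (simp_all add: block_matrix_def matrix_vector_mult_def transpose_def sum_3 vec_eq_iff forall_3 2)
qed

text \<open>Since h and its transpose both fix \<open>e3\<close>, the third row and column are those
  of the identity, and the remaining block lies in SO(2).\<close>

lemma rotation_fixing_e3:
  assumes h: "rotation_matrix h" "h *v e3 = e3"
  obtains a b where "\<And>v. h *v v = vector [a * v$1 - b * v$2, b * v$1 + a * v$2, v$3]"
proof -
  have "transpose h *v e3 = e3"
    by (rule transpose_fixes_e3[OF h])
  moreover have col: "(X *v e3) $ i = X $ i $ 3" for X :: "real^3^3" and i
    by (simp add: matrix_vector_mult_basis column_def)
  ultimately have "h $ i $ 3 = e3 $ i" "h $ 3 $ i = e3 $ i" for i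
    using h(2) col[of h i] col[of "transpose h" i] by (simp_all add: transpose_def)
  then have z: "h$1$3 = 0" "h$2$3 = 0" "h$3$3 = 1" "h$3$1 = 0" "h$3$2 = 0"
    by (simp_all add: axis_def)
  have "(transpose h ** h) $ 1 $ 1 = 1" "(transpose h ** h) $ 2 $ 2 = 1" "det h = 1"
    using rotation_matrixD[OF h(1)] by (simp_all add: mat_def)
  then have 1: "h$1$1 * h$1$1 + h$2$1 * h$2$1 = 1" "h$1$2 * h$1$2 + h$2$2 * h$2$2 = 1" "h$1$1 * h$2$2 - h$1$2 * h$2$1 = 1"
    by (simp_all add: matrix_mult_nth transpose_def det_3 z)
  note 2 = SO2_entries[OF 1]
  have "h *v v = vector [h$1$1 * v$1 - h$2$1 * v$2, h$2$1 * v$1 + h$1$1 * v$2, v$3]" for v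
    by (simp add: matrix_vector_mult_def sum_3 vec_eq_iff forall_3 2 z)
  then show ?thesis by (rule that)
qed

lemma scaled_mat_mult: "(X + c *\<^sub>R mat 1) *v v = X *v v + c *\<^sub>R v" for X :: "real^'n^'n"
  by (simp add: matrix_vector_mult_add_rdistrib flip: scaleR_matrix_vector_assoc)

lemma axial_projection_mult: "(\<chi> i j. e3 $ i * e3 $ j) *v v = (v $ 3) *\<^sub>R e3"
  by (simp add: matrix_vector_mult_def sum_3 vec_eq_iff forall_3 axis_def)

section \<open>Ranks of the constraint matrices\<close>

lemma rank_block_matrix:
  assumes "rotation_matrix C"
  shows "rank (block_matrix C 1) = 3" "rank (block_matrix C 0) = 2"
proof -
  obtain a b where ab: "a * a + b * b = 1"
    and A: "\<And>\<delta> v. block_matrix C \<delta> *v v = vector [a * v$1 - b * v$2, b * v$1 + a * v$2, \<delta> * v$3]"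
    and At: "\<And>\<delta> v. transpose (block_matrix C \<delta>) *v v = vector [a * v$1 + b * v$2, - b * v$1 + a * v$2, \<delta> * v$3]"
    using block_matrix_rotation[OF assms] by blast
  \<comment> \<open>A A^T is diagonal with entries 1, 1, \<delta>^2, so the transpose supplies
    preimages for the range in both cases.\<close>
  have AAt: "block_matrix C \<delta> *v (transpose (block_matrix C \<delta>) *v v) = vector [v$1, v$2, \<delta> * \<delta> * v$3]" for \<delta> v
  proof -
    have "a * (a * p + b * q) - b * (- b * p + a * q) = (a * a + b * b) * p"
      "b * (a * p + b * q) + a * (- b * p + a * q) = (a * a + b * b) * q" for p q
      by (simp_all add: algebra_simps)
    then show ?thesis by (simp add: A At ab mult.assoc)
  qed
  have v3: "vector [v$1, v$2, v$3] = v" for v :: "real^3"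
    by (simp add: vec_eq_iff forall_3)
  have "surj ((*v) (block_matrix C 1))"
    by (rule surjI[of _ "\<lambda>v. transpose (block_matrix C 1) *v v"]) (simp add: AAt v3)
  then show "rank (block_matrix C 1) = 3"
    by (simp add: full_rank_surjective[symmetric])
  have "range ((*v) (block_matrix C 0)) = {v. e3 \<bullet> v = 0}"
  proof (intro equalityI subsetI)
    fix v :: "real^3" assume "v \<in> {v. e3 \<bullet> v = 0}"
    then have "block_matrix C 0 *v (transpose (block_matrix C 0) *v v) = v"
      using v3[of v] by (simp add: AAt inner_axis')
    then show "v \<in> range ((*v) (block_matrix C 0))" by (rule range_eqI[OF sym])
  qed (auto simp: A inner_axis')
  then show "rank (block_matrix C 0) = 2"
    by (simp add: rank_dim_range dim_hyperplane)
qed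

lemma rank_axial_projection: "rank ((\<chi> i j. e3 $ i * e3 $ j) :: real^3^3) = 1"
proof -
  have "range ((*v) ((\<chi> i j. e3 $ i * e3 $ j) :: real^3^3)) = span {e3}"
  proof (intro equalityI subsetI)
    fix v assume "v \<in> span {e3}"
    then obtain c where "v = c *\<^sub>R e3" by (auto simp: span_singleton)
    then have "v = (\<chi> i j. e3 $ i * e3 $ j) *v (c *\<^sub>R e3)"
      by (simp add: axial_projection_mult)
    then show "v \<in> range ((*v) ((\<chi> i j. e3 $ i * e3 $ j) :: real^3^3))" by (rule range_eqI)
  qed (auto simp: axial_projection_mult span_singleton)
  then show ?thesis
    by (simp add: rank_dim_range dim_insert)
qed

text \<open>\<open>K_of_Omega\<close> and \<open>N_vec\<close> branch on j; the computed ranks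
  select the branch that matches the form of A.\<close>

lemma rolling_body_of_rank:
  assumes "m > 0" "\<forall>i. d $ i > 0" "generalized_rolling A" "rank A = j"
  obtains \<alpha> \<beta> where "rolling_body d m r A j \<alpha> \<beta>"
proof -
  have e3_nth: "e3 $ 1 = 0" "e3 $ 2 = 0" "e3 $ 3 = 1"
    by (simp_all add: axis_def)
  \<comment> \<open>\<delta> * \<delta> - 1 is the scalar \<beta>, namely 0 for rank 3 and -1 for
    rank 2. The second claim holds because plane rotations commute.\<close>
  have block: "transpose (block_matrix C \<delta>) *v (block_matrix C \<delta> *v v) = v + ((\<delta> * \<delta> - 1) * (v \<bullet> e3)) *\<^sub>R e3"
    "rotation_matrix h \<Longrightarrow> h *v e3 = e3 \<Longrightarrow> block_matrix C \<delta> *v (h *v v) = h *v (block_matrix C \<delta> *v v)"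
    if C: "rotation_matrix C" for C \<delta> v h
  proof -
    obtain a b where ab: "a * a + b * b = 1"
      and A: "\<And>\<delta> v. block_matrix C \<delta> *v v = vector [a * v$1 - b * v$2, b * v$1 + a * v$2, \<delta> * v$3]"
      and At: "\<And>\<delta> v. transpose (block_matrix C \<delta>) *v v = vector [a * v$1 + b * v$2, - b * v$1 + a * v$2, \<delta> * v$3]"
      using block_matrix_rotation[OF C] by blast
    have ab': "a * (a * p) + b * (b * p) = p" for p
      using ab by (simp flip: mult.assoc distrib_right)
    show "transpose (block_matrix C \<delta>) *v (block_matrix C \<delta> *v v) = v + ((\<delta> * \<delta> - 1) * (v \<bullet> e3)) *\<^sub>R e3"
      unfolding A At inner_axis by (simp add: vec_eq_iff forall_3 e3_nth algebra_simps ab')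
    assume "rotation_matrix h" "h *v e3 = e3"
    then obtain p q where h: "\<And>v. h *v v = vector [p * v$1 - q * v$2, q * v$1 + p * v$2, v$3]"
      using rotation_fixing_e3 by blast
    show "block_matrix C \<delta> *v (h *v v) = h *v (block_matrix C \<delta> *v v)"
      by (simp add: A h vec_eq_iff forall_3 algebra_simps)
  qed
  from assms(3) consider
      (3) C where "rotation_matrix C" "A = block_matrix C 1"
    | (2) C where "rotation_matrix C" "A = block_matrix C 0"
    | (1) "A = (\<chi> i j. e3 $ i * e3 $ j)"
    | (0) "A = 0"
    unfolding generalized_rolling_def by blast
  then show ?thesis
  proof cases
    case 3
    then have "j = 3" using assms(4) rank_block_matrix by auto
    then have "rolling_body d m r A j 1 0"
      by unfold_locales
        (use assms(1,2) 3 in \<open>simp_all add: block K_of_Omega_def N_vec_def Let_def scaled_mat_mult\<close>)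
    then show ?thesis by (rule that)
  next
    case 2
    then have "j = 2" using assms(4) rank_block_matrix by auto
    then have "rolling_body d m r A j 1 (-1)"
      by unfold_locales
        (use assms(1,2) 2 in \<open>simp_all add: block K_of_Omega_def N_vec_def Let_def scaled_mat_mult
          scaleR_right_diff_distrib add_diff_eq mult.assoc\<close>)
    then show ?thesis by (rule that)
  next
    case 1
    then have "j = 1" using assms(4) rank_axial_projection by simp
    have "transpose A = A"
      by (simp add: 1 transpose_def mult.commute)
    have "A *v (h *v v) = h *v (A *v v)" if h: "rotation_matrix h" "h *v e3 = e3" for h v
    proof -
      obtain p q where h': "\<And>v. h *v v = vector [p * v$1 - q * v$2, q * v$1 + p * v$2, v$3]"
        using rotation_fixing_e3[OF h] by blast
      show ?thesis
        unfolding 1 axial_projection_mult h' by (simp add: vec_eq_iff forall_3 e3_nth)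
    qed
    then have "rolling_body d m r A j 0 1"
      by unfold_locales
        (use assms(1,2) \<open>j = 1\<close> \<open>transpose A = A\<close> in \<open>simp_all add: K_of_Omega_def N_vec_def Let_def 1 axial_projection_mult inner_axis\<close>)
    then show ?thesis by (rule that)
  next
    case 0
    then have "j = 0" using assms(4) by simp
    then have "rolling_body d m r A j 0 0"
      by unfold_locales
        (use assms(1,2) 0 in \<open>simp_all add: K_of_Omega_def N_vec_def Let_def\<close>)
    then show ?thesis by (rule that)
  qed
qed

theorem theorem5p3:
  fixes d :: "real^3" and m r :: real and A :: "real^3^3" and j :: nat
  assumes "m > 0" and "r > 0" and "\<forall>i. d $ i > 0"
    and "generalized_rolling A" and "rank A = j"
  shows
    \<comment> \<open>the orbit projection realizes \<open>M / H\<close> as \<open>S\<^sup>2 \<times> \<real>\<^sup>3\<close>\<close>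
    "orbit_projection d m r A ` constraint_manifold d m r A = reduced_space \<and>
     (\<forall>z \<in> constraint_manifold d m r A.
        {z' \<in> constraint_manifold d m r A. orbit_projection d m r A z' = orbit_projection d m r A z} =
        {cotangent_lift config_space (action k) z | k. k \<in> sym_group}) \<and>
     \<comment> \<open>the reduced bracket exists and is given by the formula,
        computed with arbitrary smooth local extensions off \<open>norm \<gamma> = 1\<close>\<close>
     (\<exists>red. is_reduced_bracket d m r A red) \<and>
     (\<forall>red. is_reduced_bracket d m r A red \<longrightarrow>
        (\<forall>f1 \<in> smooth_functions reduced_space. \<forall>f2 \<in> smooth_functions reduced_space.
         \<forall>U F1 F2. smooth_on_open U F1 \<and> smooth_on_open U F2 \<and>
           (\<forall>y \<in> U \<inter> reduced_space. F1 y = f1 y \<and> F2 y = f2 y) \<longrightarrow>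
           (\<forall>y \<in> U \<inter> reduced_space. red f1 f2 y = rank_bracket d m r j F1 F2 y))) \<and>
     \<comment> \<open>the squared norm of \<open>\<gamma>\<close> is a Casimir function\<close>
     (\<forall>U F. smooth_on_open U F \<longrightarrow>
        (\<forall>y \<in> U. rank_bracket d m r j (\<lambda>y. (norm (fst y))\<^sup>2) F y = 0))"
proof -
  obtain \<alpha> \<beta> where "rolling_body d m r A j \<alpha> \<beta>"
    using rolling_body_of_rank[OF assms(1,3,4,5)] by blast
  then interpret rolling_body d m r A j \<alpha> \<beta> .
  show ?thesis
  proof (intro conjI allI ballI impI)
    fix red f1 f2 U F1 F2 y
    assume "is_reduced_bracket d m r A red" "f1 \<in> smooth_functions reduced_space"
      "f2 \<in> smooth_functions reduced_space"
      "smooth_on_open U F1 \<and> smooth_on_open U F2 \<and> (\<forall>y\<in>U \<inter> reduced_space. F1 y = f1 y \<and> F2 y = f2 y)"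
      "y \<in> U \<inter> reduced_space"
    then show "red f1 f2 y = rank_bracket d m r j F1 F2 y"
      by (intro reduced_bracket_eq[of red f1 f2 U F1 F2 y]) blast+
  qed (rule orbit_projection_image orbit_projection_fibre reduced_bracket_exists rank_bracket_norm_gamma; assumption?)+
qed

end
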